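(* There is a nondegenerate locally connected rational continuum which is $\omega$-sac.
   Context: A continuum is a compact connected metric space; it is nondegenerate if it has more than one point. A continuum is rational if it has a base (of open sets) all of whose elements have countable boundary. An arc in a space $X$ is a homeomorphic embedding $\alpha:[0,1]\to X$ (or its image). A topological space $X$ is $n$-strongly arc connected ($n$-sac) if for every $n$ distinct points $x_1,\dots,x_n$ of $X$ there are an arc $\alpha:[0,1]\to X$ and $t_1<t_2<\dots<t_n$ in $[0,1]$ such that $\alpha(t_i)=x_i$ for $i=1,\dots,n$. It is $\omega$-strongly arc connected ($\omega$-sac) if it is $n$-sac for every $n\geq 2$. *)

theory Defs
  imports "HOL-Analysis.Analysis"
begin

text \<open>
  A metric space is a value of the library type \<^typ>\<open>'a metric\<close>, i.e. a carrier set of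
  elements of \<^typ>\<open>'a\<close> together with a metric on that carrier.  The metric is an arbitrary one;
  it need not be related to any topology that the type \<^typ>\<open>'a\<close> itself carries.
\<close>

definition continuum :: "'a metric \<Rightarrow> bool" where
  "continuum m \<longleftrightarrow> compact_space (mtopology_of m) \<and> connected_space (mtopology_of m)"

definition nondegenerate :: "'a metric \<Rightarrow> bool" where
  "nondegenerate m \<longleftrightarrow> (\<exists>x\<in>mspace m. \<exists>y\<in>mspace m. x \<noteq> y)"

definition base_of :: "'a set set \<Rightarrow> 'a topology \<Rightarrow> bool" where
  "base_of \<B> X \<longleftrightarrow> openin X = arbitrary union_of (\<lambda>U. U \<in> \<B>)"

definition rational_space :: "'a topology \<Rightarrow> bool" where
  "rational_space X \<longleftrightarrow> (\<exists>\<B>. base_of \<B> X \<and> (\<forall>U\<in>\<B>. countable (X frontier_of U)))"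

definition arc_in :: "'a topology \<Rightarrow> (real \<Rightarrow> 'a) \<Rightarrow> bool" where
  "arc_in X \<alpha> \<longleftrightarrow> embedding_map (top_of_set {0..1}) X \<alpha>"

text \<open>
  The \<^term>\<open>n\<close> points form a family indexed by \<^term>\<open>{1..n}\<close>; the arc passes through them in
  the order of their indices.
\<close>

definition n_sac :: "nat \<Rightarrow> 'a topology \<Rightarrow> bool" where
  "n_sac n X \<longleftrightarrow>
     (\<forall>x. x ` {1..n} \<subseteq> topspace X \<and> inj_on x {1..n} \<longrightarrow>
        (\<exists>\<alpha> t. arc_in X \<alpha> \<and> t ` {1..n} \<subseteq> {0..1} \<and> strict_mono_on {1..n} t \<and>
               (\<forall>i\<in>{1..n}. \<alpha> (t i) = x i)))"

definition omega_sac :: "'a topology \<Rightarrow> bool" where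
  "omega_sac X \<longleftrightarrow> (\<forall>n\<ge>2. n_sac n X)"

text \<open>
  Existence of a space is stated over carriers inside \<^typ>\<open>nat \<Rightarrow> real\<close>.  This loses nothing:
  a compact metric space has at most continuum many points, so it is isometric to one whose carrier
  is a subset of this type.
\<close>

type_synonym point = "nat \<Rightarrow> real"

end

theory Submission
  imports Defs
begin

text \<open>
  The continuum is a book whose pages are copies of the book itself.  It lives in the Banach space of
  bounded real sequences and is the self-similar set of the contractions \<open>page a\<close> that are
  defined below, one for every natural number a.  Page 0 is a base copy.  Over its point p, page a
  with a > 0 stands at the height offset a * glue a p, and it touches page 0 exactly where glue a
  vanishes.  Iterating, every point p gets an address, the sequence of numbers of the pages on which
  p, tail p, tail (tail p), ... lie, and words w of length m index cells of level m, which have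
  diameter at most 2 * (9/10)^m.

  The gluing is tied to one point, the mark, whose address is 1, 2, 2, 2, ...: glue a vanishes at p
  iff one of the iterates number 2, ..., a + 1 of tail sends p to the mark.  Everything follows from
  four features of this choice.

  Cells of the same level with different words meet only in points that some iterate of tail sends to
  the mark.  There are only countably many such points, at most one for each finite word, so the set
  of points that have a given letter a > 0 at a given place of their address has a countable frontier.
  These sets separate points, since a common address forces equality.  Hence the book is rational
  (\<open>rational_book\<close>).

  The heights of the pages tend to 0 and the a-th page touches page 0 in a set that meets every cell
  of level less than a.  So the union of page 0 and all late pages over a small connected piece is
  again small and connected, and the book has finite covers by arbitrarily small closed connected
  pieces (\<open>fine_cover\<close>): it is compact and locally connected.

  Any two pages meet in infinitely many points, so that a finite set cannot disconnect the book
  (\<open>avoidable_finite\<close>).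

  Call a set small if for each m finitely many cells of level m cover it.  A small set contains only
  finitely many points sent to the mark by a given iterate of tail, and therefore leaves a finite
  trace on all but finitely many pages.  Together with the previous feature this shows that a small
  closed set T does not disconnect the book or any of its cells (\<open>avoidable_small\<close>).  The paths that
  witness this can again be taken small, and by joining infinitely many of them inside smaller and
  smaller cells one reaches any point x by a small path that avoids T except possibly at x
  (\<open>accessible\<close>).  Given distinct points, this allows joining them one after the other: each new
  path is chosen so that it meets the small arc built so far, and the points still to come, only at
  its own ends.  Since a path in a Banach space contains an arc, the pieces are arcs, and so is their
  union (\<open>arc_through_points\<close>).
\<close>

section \<open>Weighted sequences\<close>

text \<open>
  Bounded continuous functions form a complete space as soon as their domain is a metric space.  The
  usual distance of the natural numbers induces their discrete topology.
\<close>

instantiation nat :: metric_space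
begin

definition dist_nat :: "nat \<Rightarrow> nat \<Rightarrow> real" where "dist_nat m n = \<bar>real m - real n\<bar>"

definition uniformity_nat :: "(nat \<times> nat) filter" where
  "uniformity_nat = (INF e\<in>{0 <..}. principal {(x, y). dist x y < e})"

instance
proof
  show "open U \<longleftrightarrow> (\<forall>x\<in>U. \<forall>\<^sub>F (x', y) in uniformity. x' = x \<longrightarrow> y \<in> U)" for U :: "nat set"
  proof -
    have "{(x, y). dist x y < (1::real)} = {(x, y). x = (y::nat)}"
      by (auto simp: dist_nat_def)
    then have "\<forall>\<^sub>F (x, y) in (uniformity :: (nat \<times> nat) filter). x = y"
      unfolding uniformity_nat_def eventually_principal[symmetric]
      by (intro eventually_INF1[of 1]) (auto simp: eventually_principal)
    then have "\<forall>\<^sub>F (x', y) in uniformity. x' = x \<longrightarrow> y \<in> U" if "x \<in> U" for x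
      by (rule eventually_mono) (use that in auto)
    then show ?thesis by (simp add: open_discrete)
  qed
qed (auto simp: dist_nat_def uniformity_nat_def)

end

type_synonym bseq = "nat \<Rightarrow>\<^sub>C real"

lemma apply_Bcontfun_nat:
  fixes f :: "nat \<Rightarrow> real"
  assumes "\<And>i. \<bar>f i\<bar> \<le> B"
  shows "apply_bcontfun (Bcontfun f) = f"
proof (rule Bcontfun_inverse)
  show "f \<in> bcontfun" using assms by (auto simp: bcontfun_def bounded_iff)
qed

lemma abs_apply_le_norm: "\<bar>apply_bcontfun (p :: bseq) i\<bar> \<le> norm p"
  using norm_bounded[of p i] by simp

text \<open>
  Shifting a sequence scales it by 9/10, so that prepending an entry is a contraction for the
  supremum norm, while \<open>tail\<close> still recovers the sequence.
\<close>

definition prepend :: "real \<Rightarrow> bseq \<Rightarrow> bseq" where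
  "prepend x p = Bcontfun (\<lambda>i. case i of 0 \<Rightarrow> x | Suc j \<Rightarrow> 9/10 * apply_bcontfun p j)"

definition tail :: "bseq \<Rightarrow> bseq" where
  "tail p = Bcontfun (\<lambda>i. 10/9 * apply_bcontfun p (Suc i))"

text \<open>
  The sequence all of whose tails start with -1/2, which is the height of page 2.  It will be the
  point with address 2, 2, 2, ....
\<close>

definition twos :: bseq where "twos = Bcontfun (\<lambda>i. - 1/2 * (9/10)^i)"

lemma apply_prepend:
  "apply_bcontfun (prepend x p) = (\<lambda>i. case i of 0 \<Rightarrow> x | Suc j \<Rightarrow> 9/10 * apply_bcontfun p j)"
  unfolding prepend_def
proof (rule apply_Bcontfun_nat)
  show "\<bar>case i of 0 \<Rightarrow> x | Suc j \<Rightarrow> 9/10 * apply_bcontfun p j\<bar> \<le> max \<bar>x\<bar> (norm p)" for i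
    using abs_apply_le_norm[of p "i - 1"] by (auto split: nat.split)
qed

lemma apply_prepend_0 [simp]: "apply_bcontfun (prepend x p) 0 = x"
  by (simp add: apply_prepend)

lemma apply_prepend_Suc [simp]: "apply_bcontfun (prepend x p) (Suc i) = 9/10 * apply_bcontfun p i"
  unfolding apply_prepend by simp

lemma apply_tail [simp]: "apply_bcontfun (tail p) i = 10/9 * apply_bcontfun p (Suc i)"
proof -
  have "apply_bcontfun (tail p) = (\<lambda>i. 10/9 * apply_bcontfun p (Suc i))"
    unfolding tail_def
    by (rule apply_Bcontfun_nat[where B = "10/9 * norm p"]) (simp add: abs_mult abs_apply_le_norm)
  then show ?thesis by simp
qed

lemma apply_twos: "apply_bcontfun twos i = - 1/2 * (9/10)^i"
proof -
  have "apply_bcontfun twos = (\<lambda>i. - 1/2 * (9/10)^i)"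
    unfolding twos_def
    by (rule apply_Bcontfun_nat[where B = "1/2"]) (simp add: abs_mult power_le_one)
  then show ?thesis by simp
qed

lemma tail_prepend [simp]: "tail (prepend x p) = p"
  by (rule bcontfun_eqI) simp

lemma prepend_head_tail: "prepend (apply_bcontfun p 0) (tail p) = p"
  by (rule bcontfun_eqI, case_tac x) simp_all

lemma prepend_eq_iff [simp]: "prepend x p = prepend y q \<longleftrightarrow> x = y \<and> p = q"
  by (metis apply_prepend_0 tail_prepend)

lemma prepend_twos: "prepend (- 1/2) twos = twos"
  by (rule bcontfun_eqI, case_tac x) (simp_all add: apply_twos)

lemma tail_twos [simp]: "tail twos = twos"
  by (metis prepend_twos tail_prepend)

lemma dist_prepend_le: "dist (prepend x p) (prepend y q) \<le> max \<bar>x - y\<bar> (9/10 * dist p q)"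
proof (rule dist_bound)
  fix i
  show "dist (apply_bcontfun (prepend x p) i) (apply_bcontfun (prepend y q) i) \<le> max \<bar>x - y\<bar> (9/10 * dist p q)"
  proof (cases i)
    case (Suc j)
    have "dist (apply_bcontfun p j) (apply_bcontfun q j) \<le> dist p q" by (rule dist_bounded)
    then have "9/10 * \<bar>apply_bcontfun p j - apply_bcontfun q j\<bar> \<le> 9/10 * dist p q"
      unfolding dist_real_def by simp
    moreover have "dist (apply_bcontfun (prepend x p) i) (apply_bcontfun (prepend y q) i)
        = 9/10 * \<bar>apply_bcontfun p j - apply_bcontfun q j\<bar>"
      unfolding Suc apply_prepend_Suc dist_real_def right_diff_distrib[symmetric] abs_mult by simp
    ultimately show ?thesis by (simp only: le_max_iff_disj simp_thms)
  qed (simp add: dist_real_def)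
qed

lemma dist_head_le: "\<bar>x - y\<bar> \<le> dist (prepend x p) (prepend y q)"
  using dist_bounded[of "prepend x p" 0 "prepend y q"] by (simp add: dist_real_def)

lemma dist_tail_le: "dist (tail p) (tail q) \<le> 10/9 * dist p q"
proof (rule dist_bound)
  fix i
  have "dist (apply_bcontfun p (Suc i)) (apply_bcontfun q (Suc i)) \<le> dist p q" by (rule dist_bounded)
  then show "dist (apply_bcontfun (tail p) i) (apply_bcontfun (tail q) i) \<le> 10/9 * dist p q" 
    unfolding apply_tail dist_real_def right_diff_distrib[symmetric] abs_mult by simp
qed

lemma dist_tail_power_le: "dist ((tail ^^ n) p) ((tail ^^ n) q) \<le> (10/9)^n * dist p q"
proof (induction n)
  case (Suc n)
  have "dist ((tail ^^ Suc n) p) ((tail ^^ Suc n) q) \<le> 10/9 * dist ((tail ^^ n) p) ((tail ^^ n) q)"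
    using dist_tail_le by simp
  also have "\<dots> \<le> 10/9 * ((10/9)^n * dist p q)" using Suc by simp
  finally show ?case by simp
qed simp

lemma continuous_on_tail_power [continuous_intros]:
  "continuous_on S f \<Longrightarrow> continuous_on S (\<lambda>x. (tail ^^ n) (f x))"
proof -
  have "uniformly_continuous_on UNIV (tail ^^ n)"
    unfolding uniformly_continuous_on_def
  proof (intro allI impI)
    fix e :: real assume "e > 0"
    show "\<exists>d>0. \<forall>x\<in>UNIV. \<forall>x'\<in>UNIV. dist x' x < d \<longrightarrow> dist ((tail ^^ n) x') ((tail ^^ n) x) < e"
    proof (intro exI conjI ballI impI)
      show "e / (10/9)^n > 0" using \<open>e > 0\<close> by simp
      fix x x' :: bseq assume "dist x' x < e / (10/9)^n"
      then have "(10/9)^n * dist x' x < e" by (simp add: field_simps)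
      then show "dist ((tail ^^ n) x') ((tail ^^ n) x) < e"
        using dist_tail_power_le[of n x' x] by simp
    qed
  qed
  then have "continuous_on UNIV (tail ^^ n)" by (rule uniformly_continuous_imp_continuous)
  then show "continuous_on S f \<Longrightarrow> continuous_on S (\<lambda>x. (tail ^^ n) (f x))"
    using continuous_on_compose2 by blast
qed

lemma isCont_tail_power: "isCont (tail ^^ n) p"
  using continuous_on_tail_power[OF continuous_on_id, of UNIV n]
  by (simp add: continuous_on_eq_continuous_at)

lemma isCont_tail: "isCont tail p"
  using isCont_tail_power[where n = 1] by simp

text \<open>
  The point that will have the address 1, 2, 2, 2, ....  Its distance 3/2 from \<open>twos\<close> is what
  allows a function of slope 2/3 to take the value 0 at \<open>mark\<close> and 1 at \<open>twos\<close>.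
\<close>

definition mark :: bseq where "mark = prepend 1 twos"

lemma tail_mark [simp]: "tail mark = twos" by (simp add: mark_def)

lemma tail_power_twos [simp]: "(tail ^^ n) twos = twos" by (induction n) simp_all

lemma tail_power_mark: "n > 0 \<Longrightarrow> (tail ^^ n) mark = twos"
  by (cases n) (simp_all add: funpow_swap1)

lemma dist_twos_mark: "dist twos mark \<ge> 3/2"
  using dist_head_le[of "- 1/2" 1 twos twos] unfolding mark_def prepend_twos by simp

lemma twos_neq_mark [simp]: "twos \<noteq> mark" "mark \<noteq> twos"
  using dist_twos_mark by auto

text \<open>
  All proper tails of the mark are \<open>twos\<close>, so a point is sent to the mark at most once.
\<close>

lemma mark_depth_unique:
  assumes "(tail ^^ k) p = mark" "(tail ^^ l) p = mark"
  shows "k = l"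
proof -
  have False if k: "(tail ^^ k) p = mark" and l: "(tail ^^ l) p = mark" and "k < l" for k l
  proof -
    from \<open>k < l\<close> have "(tail ^^ (l - k)) ((tail ^^ k) p) = (tail ^^ l) p"
      by (simp flip: funpow_add o_apply[of "tail ^^ (l - k)"])
    then show False unfolding k l using tail_power_mark[of "l - k"] \<open>k < l\<close> by simp
  qed
  then show ?thesis using assms by (meson linorder_neqE_nat)
qed

section \<open>Pages\<close>

text \<open>
  The slope and the bound are matched to the distance of \<open>mark\<close> and \<open>twos\<close>: with value 1 at
  \<open>twos\<close> the pages 1 and 2 will map \<open>twos\<close> to \<open>mark\<close> and to itself, and with slope 2/3 the pages
  will still be contractions.
\<close>

definition gap :: "bseq \<Rightarrow> real" where "gap p = min 1 (2/3 * dist p mark)"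

text \<open>
  Starting at the second iterate of \<open>tail\<close> leaves two letters in front of the mark free, so that
  already the zeros of \<open>glue 1\<close> are infinitely many.  Letting the zero sets increase with the page
  number has two effects: pages a < b touch over every zero of \<open>glue a\<close>, and late pages touch page 0
  almost everywhere.
\<close>

primrec glue :: "nat \<Rightarrow> bseq \<Rightarrow> real" where
  "glue 0 p = 1"
| "glue (Suc n) p = min (glue n p) (gap ((tail ^^ (n + 2)) p))"

text \<open>
  The opposite signs of the heights 1 and -1/2 of the pages 1 and 2 keep \<open>mark\<close> and \<open>twos\<close> far
  apart.  The absolute values decrease strictly from page 1 on, which keeps different pages apart
  away from the zeros of \<open>glue\<close>.
\<close>

primrec offset :: "nat \<Rightarrow> real" where
  "offset 0 = 0"
| "offset (Suc n) = (- 1/2)^n"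

definition page :: "nat \<Rightarrow> bseq \<Rightarrow> bseq" where
  "page a p = prepend (offset a * glue a p) p"

lemma glue_range: "0 \<le> glue a p \<and> glue a p \<le> 1"
  by (induction a) (auto simp: gap_def)

lemma glue_antimono: "a \<le> b \<Longrightarrow> glue b p \<le> glue a p"
  by (induction b rule: nat_induct) (auto simp: le_Suc_eq intro: min.coboundedI1)

lemma gap_eq_0_iff: "gap p = 0 \<longleftrightarrow> p = mark"
  by (auto simp: gap_def min_def)

lemma gap_nonneg: "0 \<le> gap p"
  by (simp add: gap_def)

lemma glue_eq_0_iff: "glue a p = 0 \<longleftrightarrow> (\<exists>j<a. (tail ^^ (j + 2)) p = mark)"
proof (induction a)
  case 0
  show ?case by simp
next
  case (Suc a)
  let ?P = "\<lambda>j. (tail ^^ (j + 2)) p = mark"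
  have min_0: "min x y = 0 \<longleftrightarrow> x = 0 \<or> y = 0" if "0 \<le> x" "0 \<le> y" for x y :: real
    using that by (auto simp: min_def)
  have "glue (Suc a) p = 0 \<longleftrightarrow> glue a p = 0 \<or> gap ((tail ^^ (a + 2)) p) = 0"
    unfolding glue.simps by (rule min_0[OF conjunct1[OF glue_range] gap_nonneg])
  then have "glue (Suc a) p = 0 \<longleftrightarrow> (\<exists>j<a. ?P j) \<or> ?P a"
    by (simp only: Suc.IH gap_eq_0_iff)
  moreover have "(\<exists>j<Suc a. P j) \<longleftrightarrow> (\<exists>j<a. P j) \<or> P a" for P
    by (auto simp: less_Suc_eq)
  ultimately show ?case by (simp only:)
qed

lemma glue_twos: "glue a twos = 1"
proof (induction a)
  case (Suc a)
  have "gap twos = 1" using dist_twos_mark by (simp add: gap_def)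
  then show ?case using Suc tail_power_twos[of "a+2"] by (simp del: funpow.simps)
qed simp

lemma glue_lipschitz: "\<bar>glue a p - glue a q\<bar> \<le> 2/3 * (10/9)^(a + 1) * dist p q"
proof (induction a)
  case 0 show ?case by simp
next
  case (Suc a)
  let ?P = "(tail ^^ (a + 2)) p" and ?Q = "(tail ^^ (a + 2)) q"
  have "2/3 * (10/9)^(a + 1) * dist p q \<le> 2/3 * (10/9)^(a + 2) * dist p q"
    by (rule mult_right_mono) simp_all
  with Suc have 1: "\<bar>glue a p - glue a q\<bar> \<le> 2/3 * (10/9)^(a + 2) * dist p q"
    by (rule order_trans)
  have m: "\<bar>min x y - min x' y'\<bar> \<le> max \<bar>x - x'\<bar> \<bar>y - y'\<bar>" for x y x' y' :: real
    by (auto simp: min_def max_def)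
  have "\<bar>dist ?P mark - dist ?Q mark\<bar> \<le> dist ?P ?Q"
    by (smt (verit) dist_triangle dist_commute)
  also have "\<dots> \<le> (10/9)^(a + 2) * dist p q" by (rule dist_tail_power_le)
  finally have d: "\<bar>dist ?P mark - dist ?Q mark\<bar> \<le> (10/9)^(a + 2) * dist p q" .
  have "\<bar>gap ?P - gap ?Q\<bar> \<le> \<bar>2/3 * dist ?P mark - 2/3 * dist ?Q mark\<bar>"
    unfolding gap_def by (rule order_trans[OF m]) simp
  also have "\<dots> = 2/3 * \<bar>dist ?P mark - dist ?Q mark\<bar>"
    unfolding right_diff_distrib[symmetric] abs_mult by simp
  also have "\<dots> \<le> 2/3 * ((10/9)^(a + 2) * dist p q)" by (rule mult_left_mono[OF d]) simp
  finally have "\<bar>gap ?P - gap ?Q\<bar> \<le> 2/3 * (10/9)^(a + 2) * dist p q" by (simp only: mult.assoc)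
  with 1 have "max \<bar>glue a p - glue a q\<bar> \<bar>gap ?P - gap ?Q\<bar> \<le> 2/3 * (10/9)^(a + 2) * dist p q"
    by (rule max.boundedI)
  from order_trans[OF m this]
  have "\<bar>min (glue a p) (gap ?P) - min (glue a q) (gap ?Q)\<bar> \<le> 2/3 * (10/9)^(a + 2) * dist p q" .
  then show ?case unfolding glue.simps by (simp only: add_2_eq_Suc' Suc_eq_plus1[symmetric])
qed

text \<open>
  The slope of \<open>glue a\<close> grows with a like a power of 10/9, but the factor \<open>offset a\<close> decays like a
  power of 1/2.
\<close>

lemma offset_glue_lipschitz: "\<bar>offset a * glue a p - offset a * glue a q\<bar> \<le> 9/10 * dist p q"
proof (cases a)
  case (Suc n)
  have "\<bar>offset a * glue a p - offset a * glue a q\<bar> = (1/2)^n * \<bar>glue a p - glue a q\<bar>"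
    unfolding right_diff_distrib[symmetric] abs_mult Suc offset.simps power_abs by simp
  also have "\<dots> \<le> (1/2)^n * (2/3 * (10/9)^(a + 1) * dist p q)"
    by (intro mult_left_mono glue_lipschitz) simp
  also have "\<dots> = (5/9)^n * (200/243 * dist p q)"
  proof -
    have 1: "(1/2)^n * (10/9)^n = (5/9::real)^n" unfolding power_mult_distrib[symmetric] by simp
    have 2: "(10/9)^(a + 1) = (10/9)^n * (100/81::real)" unfolding Suc by simp
    show ?thesis unfolding 1[symmetric] 2 by algebra
  qed
  also have "\<dots> \<le> 1 * (9/10 * dist p q)"
    by (rule mult_mono) (auto intro: power_le_one)
  finally show ?thesis by simp
next
  case 0
  show ?thesis unfolding 0 offset.simps by simp
qed

lemma dist_page_le: "dist (page a p) (page a q) \<le> 9/10 * dist p q"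
  unfolding page_def
  by (rule order_trans[OF dist_prepend_le max.boundedI[OF offset_glue_lipschitz order_refl]])

lemma tail_page [simp]: "tail (page a p) = p" by (simp add: page_def)

lemma continuous_on_page [continuous_intros]:
  "continuous_on S f \<Longrightarrow> continuous_on S (\<lambda>x. page a (f x))"
proof -
  have "continuous_on UNIV (page a)"
    unfolding continuous_on_iff
  proof (intro ballI allI impI)
    fix x and e :: real assume "e > 0"
    then show "\<exists>d>0. \<forall>x'\<in>UNIV. dist x' x < d \<longrightarrow> dist (page a x') (page a x) < e"
      by (intro exI[of _ e] conjI ballI impI le_less_trans[OF dist_page_le]) auto
  qed
  then show "continuous_on S f \<Longrightarrow> continuous_on S (\<lambda>x. page a (f x))"
    using continuous_on_compose2 by blast
qed

lemma abs_offset_le_1: "\<bar>offset a\<bar> \<le> 1"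
  by (cases a) (auto simp: power_abs power_le_one)

lemma abs_offset_Suc: "\<bar>offset (Suc n)\<bar> = (1/2)^n" by (simp add: power_abs)

lemma abs_offset_le: "n \<le> a \<Longrightarrow> \<bar>offset (Suc a)\<bar> \<le> (1/2)^n"
  unfolding abs_offset_Suc by (rule power_decreasing) auto

lemma abs_offset_strict: "0 < a \<Longrightarrow> a < b \<Longrightarrow> \<bar>offset b\<bar> < \<bar>offset a\<bar>"
proof -
  assume "0 < a" "a < b"
  then obtain n m where "a = Suc n" "b = Suc m" "n < m" by (cases a; cases b) auto
  then show ?thesis unfolding \<open>a = _\<close> \<open>b = _\<close> abs_offset_Suc by (auto intro: power_strict_decreasing)
qed

text \<open>
  Points on different pages can only agree over the same point p.  There the absolute height of the
  later page is strictly smaller unless both heights are 0, because \<open>offset\<close> decreases strictly in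
  absolute value and \<open>glue\<close> decreases.
\<close>

lemma page_collision:
  assumes eq: "page a p = page b q" and "a < b"
  shows "glue b p = 0"
proof (rule ccontr)
  assume *: "glue b p \<noteq> 0"
  have e: "offset a * glue a p = offset b * glue b p"
    using eq unfolding page_def by auto
  have "offset b \<noteq> 0" using \<open>a < b\<close> by (cases b) auto
  then have a: "a > 0" using e * by (cases a) auto
  have pos: "glue b p > 0" using * glue_range[of b p] by linarith
  have "\<bar>offset b * glue b p\<bar> < \<bar>offset a\<bar> * glue b p"
    using pos abs_offset_strict[OF a \<open>a < b\<close>] by (simp add: abs_mult)
  also have "\<dots> \<le> \<bar>offset a\<bar> * glue a p"
    using glue_antimono[of a b p] \<open>a < b\<close> by (intro mult_left_mono) auto
  also have "\<dots> = \<bar>offset a * glue a p\<bar>" using glue_range[of a p] by (simp add: abs_mult)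
  finally show False using e by simp
qed

lemma page_eq_mark_depth:
  assumes "page a p = page b q" "a < b"
  shows "\<exists>k. 0 < k \<and> k \<le> b + 1 \<and> (tail ^^ k) p = mark"
proof -
  obtain j where "j < b" "(tail ^^ (j + 2)) p = mark"
    using page_collision[OF assms] unfolding glue_eq_0_iff by blast
  then show ?thesis by (intro exI[of _ "j + 2"] conjI) simp_all
qed

lemma page_glued:
  assumes "(tail ^^ (j + 2)) p = mark" "j < a"
  shows "page a p = page 0 p"
proof -
  have "glue a p = 0" unfolding glue_eq_0_iff using assms by blast
  then show ?thesis by (simp add: page_def)
qed

lemma page_1_twos: "page 1 twos = mark"
  by (simp only: page_def mark_def glue_twos) simp

lemma page_2_twos: "page 2 twos = twos"
proof -
  have "offset 2 = - 1/2" by (simp add: numeral_2_eq_2)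
  then show ?thesis unfolding page_def glue_twos by (simp only: mult_1_right prepend_twos)
qed

text \<open>
  With two free letters c and d, these points are common to all pages.  As d varies there are
  infinitely many of them for each c, and c can be chosen to lie on a prescribed subpage: paths use
  them to change from one page to another.
\<close>

lemma portal_glued: "page a (page c (page d mark)) = page b (page c (page d mark))"
proof -
  have "page a (page c (page d mark)) = page 0 (page c (page d mark))" for a
  proof (cases a)
    case (Suc n)
    have "(tail ^^ (0 + 2)) (page c (page d mark)) = mark" by (simp add: numeral_2_eq_2)
    then show ?thesis by (rule page_glued) (simp add: Suc)
  qed simp
  then show ?thesis by metis
qed

lemma norm_page_le: "norm p \<le> 1 \<Longrightarrow> norm (page a p) \<le> 1"
proof -
  assume "norm p \<le> 1"
  have p0: "prepend 0 0 = (0::bseq)" by (rule bcontfun_eqI, case_tac x) simp_all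
  have "norm (page a p) \<le> max \<bar>offset a * glue a p\<bar> (9/10 * norm p)"
    using dist_prepend_le[of "offset a * glue a p" p 0 0] unfolding page_def p0 by simp
  moreover have "\<bar>offset a * glue a p\<bar> \<le> 1 * 1"
    unfolding abs_mult using glue_range[of a p] abs_offset_le_1[of a] by (intro mult_mono) auto
  ultimately show ?thesis using \<open>norm p \<le> 1\<close> by simp
qed

section \<open>The book and its cells\<close>

text \<open>
  The greatest subset of the unit ball that is covered by its own images under the pages.
\<close>

definition book :: "bseq set" where
  "book = {p. \<forall>n. norm ((tail ^^ n) p) \<le> 1 \<and> (\<exists>a. (tail ^^ n) p = page a ((tail ^^ Suc n) p))}"

lemma book_norm: "p \<in> book \<Longrightarrow> norm p \<le> 1"
  unfolding book_def by (drule CollectD, drule spec[of _ 0]) simp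

lemma book_page_tail: "p \<in> book \<Longrightarrow> \<exists>a. p = page a (tail p)"
  unfolding book_def by (drule CollectD, drule spec[of _ 0]) simp

lemma book_coinduct:
  assumes "p \<in> Y" and Y: "\<And>p. p \<in> Y \<Longrightarrow> norm p \<le> 1 \<and> (\<exists>a. \<exists>q\<in>Y. p = page a q)"
  shows "p \<in> book"
proof -
  have tl: "tail p \<in> Y \<and> (\<exists>a. p = page a (tail p))" if "p \<in> Y" for p
    using Y[OF that] by force
  have "(tail ^^ n) p \<in> Y" for n
    by (induction n) (use tl \<open>p \<in> Y\<close> in auto)
  then have "norm ((tail ^^ n) p) \<le> 1 \<and> (\<exists>a. (tail ^^ n) p = page a (tail ((tail ^^ n) p)))" for n
    using Y tl by blast
  then show ?thesis unfolding book_def by simp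
qed

lemma tail_in_book:
  assumes "p \<in> book" shows "tail p \<in> book"
proof -
  have "norm ((tail ^^ n) (tail p)) \<le> 1 \<and> (\<exists>a. (tail ^^ n) (tail p) = page a ((tail ^^ Suc n) (tail p)))" for n
  proof -
    have "norm ((tail ^^ Suc n) p) \<le> 1 \<and> (\<exists>a. (tail ^^ Suc n) p = page a ((tail ^^ Suc (Suc n)) p))"
      using assms unfolding book_def by blast
    then show ?thesis by (simp only: funpow_Suc_right o_apply)
  qed
  then show ?thesis unfolding book_def by blast
qed

lemma tail_power_in_book: "p \<in> book \<Longrightarrow> (tail ^^ n) p \<in> book"
  by (induction n) (auto intro: tail_in_book)

lemma page_in_book:
  assumes p: "p \<in> book" shows "page a p \<in> book"
proof (rule book_coinduct[where Y = "insert (page a p) book"])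
  show "page a p \<in> insert (page a p) book" by simp
next
  fix q assume q: "q \<in> insert (page a p) book"
  show "norm q \<le> 1 \<and> (\<exists>b. \<exists>r\<in>insert (page a p) book. q = page b r)"
  proof (cases "q = page a p")
    case True
    then show ?thesis using p norm_page_le[OF book_norm[OF p]] by blast
  next
    case False
    then have "q \<in> book" using q by simp
    then show ?thesis using book_norm book_page_tail tail_in_book by blast
  qed
qed

lemma norm_twos_le: "norm twos \<le> 1"
proof (rule norm_bound)
  show "norm (apply_bcontfun twos i) \<le> 1" for i
    using power_le_one[of "9/10::real" i] by (simp add: apply_twos abs_mult)
qed

lemma twos_in_book: "twos \<in> book"
proof (rule book_coinduct[of _ "{twos}"])
  fix q assume "q \<in> {twos}"
  then show "norm q \<le> 1 \<and> (\<exists>a. \<exists>r\<in>{twos}. q = page a r)"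
    using norm_twos_le page_2_twos by (auto intro!: exI[of _ 2])
qed simp

lemma mark_in_book: "mark \<in> book"
  unfolding page_1_twos[symmetric] by (rule page_in_book[OF twos_in_book])

primrec pages :: "nat list \<Rightarrow> bseq \<Rightarrow> bseq" where
  "pages [] p = p"
| "pages (a # w) p = page a (pages w p)"

definition cell :: "nat list \<Rightarrow> bseq set" where "cell w = pages w ` book"

lemma pages_append: "pages (v @ w) p = pages v (pages w p)"
  by (induction v) auto

lemma pages_in_book: "p \<in> book \<Longrightarrow> pages w p \<in> book"
  by (induction w) (auto intro: page_in_book)

lemma cell_Cons: "cell (a # w) = page a ` cell w"
  by (auto simp: cell_def)

lemma cell_subset_book: "cell w \<subseteq> book"
  unfolding cell_def using pages_in_book by auto

lemma tail_pages [simp]: "(tail ^^ length w) (pages w p) = p"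
  by (induction w) (simp_all add: funpow_swap1)

lemma dist_pages_le: "dist (pages w p) (pages w q) \<le> (9/10)^length w * dist p q"
proof (induction w)
  case (Cons a w)
  have "dist (pages (a # w) p) (pages (a # w) q) \<le> 9/10 * dist (pages w p) (pages w q)"
    using dist_page_le by simp
  then show ?case using Cons by simp
qed simp

lemma book_dist_le: "p \<in> book \<Longrightarrow> q \<in> book \<Longrightarrow> dist p q \<le> 2"
  using book_norm[of p] book_norm[of q] norm_triangle_ineq4[of p q] by (simp add: dist_norm)

lemma cell_dist_le:
  assumes "p \<in> cell w" "q \<in> cell w" shows "dist p q \<le> 2 * (9/10)^length w"
proof -
  obtain p' q' where pq: "p' \<in> book" "q' \<in> book" "p = pages w p'" "q = pages w q'"
    using assms unfolding cell_def by auto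
  have "(9/10)^length w * dist p' q' \<le> (9/10)^length w * 2"
    using pq by (intro mult_left_mono book_dist_le) auto
  then show ?thesis using dist_pages_le[of w p' q'] unfolding pq by linarith
qed

lemma book_address: "p \<in> book \<Longrightarrow> \<exists>w. length w = n \<and> p = pages w ((tail ^^ n) p)"
proof (induction n arbitrary: p)
  case (Suc n)
  obtain a where a: "p = page a (tail p)" using book_page_tail Suc.prems by blast
  obtain w where "length w = n" "tail p = pages w ((tail ^^ n) (tail p))"
    using Suc.IH[OF tail_in_book[OF Suc.prems]] by blast
  then have "length (a # w) = Suc n \<and> p = pages (a # w) ((tail ^^ Suc n) p)"
    using a by (simp add: funpow_swap1)
  then show ?case by blast
qed auto

lemma book_cell: "p \<in> book \<Longrightarrow> \<exists>w. length w = n \<and> p \<in> cell w"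
  using book_address[of p n] tail_power_in_book[of p n] unfolding cell_def by blast

text \<open>
  Removing a common first letter multiplies the distance by at least 10/9, and distances in the book
  are bounded.
\<close>

lemma common_address_eq:
  assumes "p \<in> book" "q \<in> book"
    and common: "\<And>n. \<exists>a. (tail ^^ n) p = page a ((tail ^^ Suc n) p) \<and> (tail ^^ n) q = page a ((tail ^^ Suc n) q)"
  shows "p = q"
proof -
  have "dist p q \<le> (9/10)^n * dist ((tail ^^ n) p) ((tail ^^ n) q)" for n
  proof (induction n)
    case (Suc n)
    obtain a where a: "(tail ^^ n) p = page a ((tail ^^ Suc n) p)" "(tail ^^ n) q = page a ((tail ^^ Suc n) q)"
      using common by blast
    have "dist ((tail ^^ n) p) ((tail ^^ n) q) \<le> 9/10 * dist ((tail ^^ Suc n) p) ((tail ^^ Suc n) q)"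
      using dist_page_le[of a "(tail ^^ Suc n) p" "(tail ^^ Suc n) q"] by (simp only: a[symmetric])
    then have "(9/10)^n * dist ((tail ^^ n) p) ((tail ^^ n) q) \<le> (9/10)^n * (9/10 * dist ((tail ^^ Suc n) p) ((tail ^^ Suc n) q))"
      by (rule mult_left_mono) simp
    with Suc have "dist p q \<le> (9/10)^n * (9/10 * dist ((tail ^^ Suc n) p) ((tail ^^ Suc n) q))" by linarith
    then show ?case by (simp only: power_Suc mult_ac)
  qed simp
  moreover have "(9/10)^n * dist ((tail ^^ n) p) ((tail ^^ n) q) \<le> (9/10)^n * 2" for n
    by (intro mult_left_mono book_dist_le tail_power_in_book assms) simp
  ultimately have *: "dist p q \<le> (9/10)^n * 2" for n
    by (rule order_trans)
  have "(\<lambda>n. (9/10)^n * 2) \<longlonglongrightarrow> (0::real)"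
    by (intro tendsto_mult_left_zero LIMSEQ_realpow_zero) auto
  then have "dist p q \<le> 0" by (rule LIMSEQ_le_const) (use * in auto)
  then show ?thesis by simp
qed

text \<open>
  At the first place where the words differ, two pages meet; points where pages meet are sent to
  the mark.  The bound K depends only on the letters of the two words.
\<close>

lemma cells_meet_mark_depth:
  assumes "length w = length w'" "w \<noteq> w'"
  shows "\<exists>K. \<forall>p \<in> cell w \<inter> cell w'. \<exists>k\<le>K. (tail ^^ k) p = mark"
  using assms
proof (induction w w' rule: list_induct2)
  case (Cons a w b w')
  show ?case
  proof (cases "a = b")
    case True
    then obtain K where K: "\<forall>p \<in> cell w \<inter> cell w'. \<exists>k\<le>K. (tail ^^ k) p = mark" using Cons by auto
    have "\<exists>k\<le>Suc K. (tail ^^ k) p = mark" if p: "p \<in> cell (a # w) \<inter> cell (b # w')" for p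
    proof -
      obtain q r where q: "p = page a q" "q \<in> cell w" and r: "p = page a r" "r \<in> cell w'"
        using p True unfolding cell_Cons by blast
      then have "q \<in> cell w'" using tail_page by metis
      then obtain k where "k \<le> K" "(tail ^^ k) q = mark" using K q by blast
      then show ?thesis using q by (intro exI[of _ "Suc k"]) (simp add: funpow_swap1)
    qed
    then show ?thesis by blast
  next
    case False
    have "\<exists>k\<le>Suc (max a b + 1). (tail ^^ k) p = mark" if p: "p \<in> cell (a # w) \<inter> cell (b # w')" for p
    proof -
      obtain q r where q: "p = page a q" "p = page b r" using p unfolding cell_Cons by blast
      have "q = r" using q tail_page by metis
      have "\<exists>k. k \<le> max a b + 1 \<and> (tail ^^ k) q = mark"
      proof (cases a b rule: linorder_cases)
        case less
        then show ?thesis using page_eq_mark_depth[of a q b r] q \<open>q = r\<close> by (auto simp: max_def)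
      next
        case greater
        then show ?thesis using page_eq_mark_depth[of b r a q] q \<open>q = r\<close> by (auto simp: max_def)
      qed (use False in simp)
      then obtain k where "k \<le> max a b + 1" "(tail ^^ k) q = mark" by blast
      then show ?thesis using q by (intro exI[of _ "Suc k"]) (simp add: funpow_swap1)
    qed
    then show ?thesis by blast
  qed
qed simp

text \<open>
  The union is infinite, but its pages accumulate only on page 0, which belongs to it.
\<close>

lemma closed_pages:
  assumes N: "closed N" and "0 \<in> B"
  shows "closed (\<Union>b\<in>B. page b ` N)"
proof -
  have cont_tail: "continuous_on UNIV tail"
    by (simp add: continuous_on_eq_continuous_at isCont_tail)
  have cont_head: "continuous_on UNIV (\<lambda>p::bseq. apply_bcontfun p 0)"
    unfolding continuous_on_iff
    by (intro ballI allI impI exI conjI le_less_trans[OF dist_bounded]) auto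
  have N': "closed {p. tail p \<in> N}"
    using continuous_closed_vimage[OF N isCont_tail] by (simp add: vimage_def)
  have page: "closed {p. p = page b (tail p)}" for b
    by (intro closed_Collect_eq continuous_on_id continuous_on_page cont_tail)
  \<comment> \<open>All pages after the n-th one lie in a closed slab of thickness (1/2)^n around page 0.\<close>
  define A where "A n = {p. tail p \<in> N} \<inter> ({p. \<bar>apply_bcontfun p 0\<bar> \<le> (1/2)^n} \<union>
      (\<Union>b\<in>B \<inter> {..n}. {p. p = page b (tail p)}))" for n
  have closed_A: "closed (A n)" for n
    unfolding A_def
    by (intro closed_Int closed_Un N' closed_UN page closed_Collect_le continuous_on_const
        continuous_on_rabs cont_head ballI) auto
  have "(\<Union>b\<in>B. page b ` N) = (\<Inter>n. A n)"
  proof (intro equalityI subsetI)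
    fix p assume "p \<in> (\<Union>b\<in>B. page b ` N)"
    then obtain b q where b: "b \<in> B" "q \<in> N" "p = page b q" by blast
    have "p \<in> A n" for n
    proof (cases "b \<le> n")
      case True
      then show ?thesis unfolding A_def using b by auto
    next
      case False
      then obtain m where m: "b = Suc m" "n \<le> m" by (cases b) auto
      have "\<bar>apply_bcontfun p 0\<bar> = \<bar>offset b\<bar> * glue b q"
        using glue_range[of b q] by (simp add: b page_def abs_mult)
      also have "\<dots> \<le> (1/2)^n * 1"
        using glue_range[of b q] abs_offset_le[OF m(2)] m(1) by (intro mult_mono) auto
      finally show ?thesis unfolding A_def using b by auto
    qed
    then show "p \<in> (\<Inter>n. A n)" by blast
  next
    fix p assume p: "p \<in> (\<Inter>n. A n)"
    then have tl: "tail p \<in> N" by (auto simp: A_def)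
    show "p \<in> (\<Union>b\<in>B. page b ` N)"
    proof (cases "\<exists>b\<in>B. p = page b (tail p)")
      case True
      then show ?thesis using tl by blast
    next
      case False
      have *: "\<bar>apply_bcontfun p 0\<bar> \<le> (1/2)^n" for n
      proof -
        have "p \<in> A n" using p by blast
        then show ?thesis using False unfolding A_def by blast
      qed
      have "(\<lambda>n. (1/2)^n) \<longlonglongrightarrow> (0::real)" by (rule LIMSEQ_realpow_zero) auto
      then have "\<bar>apply_bcontfun p 0\<bar> \<le> 0" by (rule LIMSEQ_le_const) (use * in auto)
      then have "p = page 0 (tail p)" using prepend_head_tail[of p] by (simp add: page_def)
      then show ?thesis using False \<open>0 \<in> B\<close> by blast
    qed
  qed
  then show ?thesis using closed_A by (simp add: closed_INT)
qed

lemma closed_page_image: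
  assumes "closed N" shows "closed (page b ` N)"
proof -
  have cont_tail: "continuous_on UNIV tail"
    by (simp add: continuous_on_eq_continuous_at isCont_tail)
  have "closed (tail -` N)"
    by (rule continuous_closed_vimage[OF assms isCont_tail])
  moreover have "closed {p. p = page b (tail p)}"
    by (intro closed_Collect_eq continuous_on_id continuous_on_page cont_tail)
  moreover have "page b ` N = tail -` N \<inter> {p. p = page b (tail p)}" by auto
  ultimately show ?thesis by auto
qed

lemma closed_book: "closed book"
proof -
  let ?S = "\<Union>b\<in>UNIV. page b ` UNIV"
  have eq: "book = (\<Inter>n. (tail ^^ n) -` (cball 0 1 \<inter> ?S))"
  proof (intro set_eqI iffI)
    fix p assume "p \<in> book"
    then have n: "norm ((tail ^^ n) p) \<le> 1 \<and> (\<exists>a. (tail ^^ n) p = page a ((tail ^^ Suc n) p))" for n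
      unfolding book_def by blast
    have "(tail ^^ n) p \<in> cball 0 1 \<inter> ?S" for n
      using n[of n] by (auto simp del: funpow.simps)
    then show "p \<in> (\<Inter>n. (tail ^^ n) -` (cball 0 1 \<inter> ?S))" by blast
  next
    fix p assume p: "p \<in> (\<Inter>n. (tail ^^ n) -` (cball 0 1 \<inter> ?S))"
    have "norm ((tail ^^ n) p) \<le> 1 \<and> (\<exists>a. (tail ^^ n) p = page a ((tail ^^ Suc n) p))" for n
    proof -
      have "(tail ^^ n) p \<in> cball 0 1 \<inter> ?S" using p by blast
      then show ?thesis by force
    qed
    then show "p \<in> book" unfolding book_def by blast
  qed
  have "closed ((tail ^^ n) -` (cball 0 1 \<inter> ?S))" for n
  proof (rule continuous_closed_vimage)
    show "closed (cball 0 1 \<inter> ?S)" by (intro closed_Int closed_cball closed_pages) auto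
    show "isCont (tail ^^ n) x" for x by (rule isCont_tail_power)
  qed
  then show ?thesis unfolding eq by (intro closed_INT ballI)
qed

section \<open>Sets met by finitely many cells\<close>

text \<open>
  This is the class of sets that can be avoided.  It contains all finite subsets of the book, it is
  closed under finite unions, and it is wide enough to contain suitable paths between any two points
  of the book.
\<close>

definition small :: "bseq set \<Rightarrow> bool" where
  "small T \<longleftrightarrow> (\<forall>m. \<exists>W. finite W \<and> (\<forall>w\<in>W. length w = m) \<and> T \<subseteq> (\<Union>w\<in>W. cell w))"

lemma smallD:
  assumes "small T"
  obtains W where "finite W" "\<And>w. w \<in> W \<Longrightarrow> length w = m" "T \<subseteq> (\<Union>w\<in>W. cell w)"
  using assms unfolding small_def by metis

lemma small_subset: "small T \<Longrightarrow> S \<subseteq> T \<Longrightarrow> small S"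
  unfolding small_def by (meson order_trans)

lemma small_Un: "small S \<Longrightarrow> small T \<Longrightarrow> small (S \<union> T)"
  unfolding small_def
proof
  fix m
  assume S: "\<forall>m. \<exists>W. finite W \<and> (\<forall>w\<in>W. length w = m) \<and> S \<subseteq> (\<Union>w\<in>W. cell w)"
    and T: "\<forall>m. \<exists>W. finite W \<and> (\<forall>w\<in>W. length w = m) \<and> T \<subseteq> (\<Union>w\<in>W. cell w)"
  obtain V W where "finite V" "\<forall>w\<in>V. length w = m" "S \<subseteq> (\<Union>w\<in>V. cell w)"
    "finite W" "\<forall>w\<in>W. length w = m" "T \<subseteq> (\<Union>w\<in>W. cell w)"
    using S T by meson
  then show "\<exists>W. finite W \<and> (\<forall>w\<in>W. length w = m) \<and> S \<union> T \<subseteq> (\<Union>w\<in>W. cell w)"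
    by (intro exI[of _ "V \<union> W"]) auto
qed

lemma small_empty [simp]: "small {}"
  unfolding small_def by (intro allI exI[of _ "{}"]) simp

lemma small_singleton: "p \<in> book \<Longrightarrow> small {p}"
  unfolding small_def
proof
  fix m assume "p \<in> book"
  then obtain w where "length w = m" "p \<in> cell w" using book_cell by blast
  then show "\<exists>W. finite W \<and> (\<forall>w\<in>W. length w = m) \<and> {p} \<subseteq> (\<Union>w\<in>W. cell w)"
    by (intro exI[of _ "{w}"]) simp
qed

lemma small_finite: "finite T \<Longrightarrow> T \<subseteq> book \<Longrightarrow> small T"
proof (induction T rule: finite_induct)
  case (insert p T)
  then show ?case using small_Un[OF small_singleton, of p T] by simp
qed simp

lemma cell_mark_depth:
  assumes "p \<in> cell w" "(tail ^^ length w) p = mark"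
  shows "p = pages w mark"
  using assms unfolding cell_def by auto

text \<open>
  A cell of level k has only one point that the k-th iterate of \<open>tail\<close> sends to the mark.
\<close>

lemma small_imp_finite_marks:
  assumes "small T"
  shows "finite {p \<in> T. (tail ^^ k) p = mark}"
proof -
  obtain W where W: "finite W" "\<And>w. w \<in> W \<Longrightarrow> length w = k" "T \<subseteq> (\<Union>w\<in>W. cell w)"
    using assms smallD by metis
  have "{p \<in> T. (tail ^^ k) p = mark} \<subseteq> (\<lambda>w. pages w mark) ` W"
    using W(2,3) cell_mark_depth by fastforce
  then show ?thesis using W(1) finite_surj by blast
qed

lemma small_cover_Cons:
  assumes "\<And>m. \<exists>W. finite W \<and> (\<forall>w\<in>W. length w = m) \<and> P \<subseteq> (\<Union>w\<in>W. cell (a # w))"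
    and "P \<subseteq> book"
  shows "small P"
  unfolding small_def
proof
  fix m
  show "\<exists>W. finite W \<and> (\<forall>w\<in>W. length w = m) \<and> P \<subseteq> (\<Union>w\<in>W. cell w)"
  proof (cases m)
    case 0
    then show ?thesis using \<open>P \<subseteq> book\<close> by (intro exI[of _ "{[]}"]) (simp add: cell_def)
  next
    case (Suc n)
    obtain W where "finite W" "\<forall>w\<in>W. length w = n" "P \<subseteq> (\<Union>w\<in>W. cell (a # w))"
      using assms(1)[of n] by (elim exE conjE)
    then have "finite ((#) a ` W) \<and> (\<forall>w\<in>(#) a ` W. length w = m) \<and> P \<subseteq> (\<Union>w\<in>(#) a ` W. cell w)"
      unfolding Suc image_image by simp
    then show ?thesis by blast
  qed
qed

lemma small_subset_book: "small T \<Longrightarrow> T \<subseteq> book"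
  by (rule smallD[of T 0]) (use cell_subset_book in blast)+

lemma small_page:
  assumes "small P" shows "small (page a ` P)"
proof (rule small_cover_Cons)
  fix m
  obtain W where "finite W" "\<And>w. w \<in> W \<Longrightarrow> length w = m" "P \<subseteq> (\<Union>w\<in>W. cell w)"
    using assms smallD by metis
  then show "\<exists>W. finite W \<and> (\<forall>w\<in>W. length w = m) \<and> page a ` P \<subseteq> (\<Union>w\<in>W. cell (a # w))"
    unfolding cell_Cons by (intro exI[of _ W]) blast
next
  show "page a ` P \<subseteq> book" using small_subset_book[OF assms] page_in_book by blast
qed

text \<open>
  The trace of a set on a page, pulled back to the book along the self-similarity.
\<close>

definition on_page :: "nat \<Rightarrow> bseq set \<Rightarrow> bseq set" where
  "on_page a T = {p \<in> book. page a p \<in> T}"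

text \<open>
  A point of page a in a cell with a first letter other than a also lies in the cell with that letter
  replaced by a, because pages only meet over the same point.  Dropping the first letters of the
  words of a cover therefore gives a cover of the trace.
\<close>

lemma small_on_page:
  assumes "small T" shows "small (on_page a T)"
  unfolding small_def
proof
  fix m
  obtain W where W: "finite W" "\<And>w. w \<in> W \<Longrightarrow> length w = Suc m" "T \<subseteq> (\<Union>w\<in>W. cell w)"
    using assms smallD by metis
  have "on_page a T \<subseteq> (\<Union>w\<in>tl ` W. cell w)"
  proof
    fix p assume "p \<in> on_page a T"
    then obtain w where w: "w \<in> W" "page a p \<in> cell w" using W(3) by (auto simp: on_page_def)
    then obtain b v where "w = b # v" using W(2) by (metis length_Suc_conv)
    then have "page a p \<in> page b ` cell v" using w by (simp add: cell_Cons)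
    then obtain q where "q \<in> cell v" "page a p = page b q" by blast
    then have "p \<in> cell (tl w)" using \<open>w = b # v\<close> tail_page[of a p] tail_page[of b q] by simp
    then show "p \<in> (\<Union>w\<in>tl ` W. cell w)" using w by blast
  qed
  then show "\<exists>W. finite W \<and> (\<forall>w\<in>W. length w = m) \<and> on_page a T \<subseteq> (\<Union>w\<in>W. cell w)"
    using W by (intro exI[of _ "tl ` W"]) auto
qed

section \<open>Paths in the book\<close>

text \<open>
  Infinitely many consecutive paths that converge to a point x form, together with x, one path.
  Running through the n-th path in the time from n to n + 1 gives a continuous map G on the
  half-line, and t / (1 - t) compresses the half-line to the unit interval.
\<close>

lemma path_infinite_join:
  fixes \<gamma> :: "nat \<Rightarrow> real \<Rightarrow> 'a::metric_space"
  assumes path: "\<And>n. path (\<gamma> n)"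
    and join: "\<And>n. pathfinish (\<gamma> n) = pathstart (\<gamma> (Suc n))"
    and lim: "\<And>e. e > 0 \<Longrightarrow> \<exists>N. \<forall>n\<ge>N. path_image (\<gamma> n) \<subseteq> ball x e"
  obtains g where "path g" "pathstart g = pathstart (\<gamma> 0)" "pathfinish g = x"
    "path_image g \<subseteq> insert x (\<Union>n. path_image (\<gamma> n))"
proof -
  define G where "G s = \<gamma> (nat \<lfloor>s\<rfloor>) (s - of_int \<lfloor>s\<rfloor>)" for s :: real
  define g where "g t = (if t < 1 then G (t / (1 - t)) else x)" for t :: real
  have G_eq: "G s = \<gamma> n (s - real n)" if "s \<in> {real n..real (Suc n)}" for s n
  proof (cases "s = real (Suc n)")
    case True
    then have "\<lfloor>s\<rfloor> = int (Suc n)" by (simp add: floor_unique)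
    then have "G s = pathstart (\<gamma> (Suc n))" unfolding G_def pathstart_def True by (simp add: nat_add_distrib)
    also have "\<dots> = \<gamma> n (s - real n)" unfolding join[symmetric] pathfinish_def True by simp
    finally show ?thesis .
  next
    case False
    then have "\<lfloor>s\<rfloor> = int n" using that by (intro floor_unique) auto
    then show ?thesis unfolding G_def by simp
  qed
  have G_image: "G s \<in> path_image (\<gamma> (nat \<lfloor>s\<rfloor>))" for s
    unfolding G_def path_image_def by (intro imageI) (simp, linarith)
  have G_cont: "continuous_on {0..real n} G" for n
  proof (induction n)
    case (Suc n)
    have "continuous_on {real n..real (Suc n)} (\<lambda>s. \<gamma> n (s - real n))"
      using path[of n] unfolding path_def
      by (rule continuous_on_compose2) (auto intro!: continuous_intros)
    then have "continuous_on {real n..real (Suc n)} G"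
      by (rule continuous_on_eq) (simp only: G_eq)
    then have "continuous_on ({0..real n} \<union> {real n..real (Suc n)}) G"
      by (intro continuous_on_closed_Un Suc) auto
    moreover have "{0..real n} \<union> {real n..real (Suc n)} = {0..real (Suc n)}" by auto
    ultimately show ?case by simp
  qed simp
  have at1: "\<exists>d>0. \<forall>t\<in>{0..1}. dist t 1 < d \<longrightarrow> dist (g t) (g 1) < e" if e: "e > 0" for e
  proof -
    obtain N where N: "\<And>n. n \<ge> N \<Longrightarrow> path_image (\<gamma> n) \<subseteq> ball x e" using lim[OF e] by blast
    have "dist (g t) (g 1) < e" if t: "t \<in> {0..1}" "dist t 1 < 1 / (real N + 1)" for t
    proof (cases "t < 1")
      case True
      have "1 - t < 1 / (real N + 1)" using t by (simp add: dist_real_def)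
      then have "(1 - t) * (real N + 1) < 1" by (simp add: pos_less_divide_eq)
      then have "real N * (1 - t) \<le> t" by (simp add: algebra_simps)
      then have "real N \<le> t / (1 - t)" using True by (simp add: pos_le_divide_eq)
      then have "nat \<lfloor>t / (1 - t)\<rfloor> \<ge> N" by (simp add: le_nat_iff le_floor_iff)
      then have "G (t / (1 - t)) \<in> ball x e" using N G_image by blast
      then show ?thesis using True unfolding g_def by (simp add: dist_commute)
    next
      case False then show ?thesis using t \<open>e > 0\<close> by (simp add: g_def)
    qed
    then show ?thesis by (intro exI[of _ "1 / (real N + 1)"]) auto
  qed
  have "path g"
    unfolding path_def continuous_on_eq_continuous_within
  proof
    fix t :: real assume t: "t \<in> {0..1}"
    show "continuous (at t within {0..1}) g"
    proof (cases "t < 1")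
      case True
      define t' where "t' = (1 + t) / 2"
      have t': "t < t'" "t' < 1" using True by (auto simp: t'_def)
      obtain n where n: "t' / (1 - t') \<le> real n" using real_arch_simple by blast
      have "continuous_on {0..t'} (\<lambda>t. G (t / (1 - t)))"
      proof (rule continuous_on_compose2[OF G_cont[of n]])
        show "continuous_on {0..t'} (\<lambda>t. t / (1 - t))"
          using t' by (intro continuous_intros) auto
        have "u / (1 - u) \<le> t' / (1 - t')" if "u \<in> {0..t'}" for u
          using that t' by (intro frac_le) auto
        then show "(\<lambda>t. t / (1 - t)) ` {0..t'} \<subseteq> {0..real n}"
          using n t' by fastforce
      qed
      then have "continuous_on {0..t'} g"
        by (rule continuous_on_eq) (use t' in \<open>auto simp: g_def\<close>)
      then have "continuous (at t within {0..t'}) g"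
        using t t' by (auto simp: continuous_on_eq_continuous_within)
      moreover have "at t within {0..t'} = at t within {0..1}"
        using t t' by (intro at_within_nhd[of _ "{..<t'}"]) auto
      ultimately show ?thesis by (simp add: continuous_within)
    next
      case False
      then have "t = 1" using t by simp
      then show ?thesis using at1 unfolding continuous_within_eps_delta by blast
    qed
  qed
  moreover have "pathstart g = pathstart (\<gamma> 0)"
    by (simp add: pathstart_def g_def G_def)
  moreover have "pathfinish g = x" by (simp add: pathfinish_def g_def)
  moreover have "path_image g \<subseteq> insert x (\<Union>n. path_image (\<gamma> n))"
    unfolding path_image_def[of g] g_def using G_image by auto
  ultimately show ?thesis using that by blast
qed

text \<open>
  Some point over which all pages meet; it serves as the turning point of the routes below.
\<close>

definition hinge :: bseq where "hinge = page 0 (page 0 mark)"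

lemma hinge_in_book: "hinge \<in> book"
  unfolding hinge_def by (intro page_in_book mark_in_book)

lemma page_hinge: "page a hinge = page b hinge"
  unfolding hinge_def by (rule portal_glued)

text \<open>
  Points over which pages meet have several addresses; one is chosen for each point.
\<close>

definition letter :: "bseq \<Rightarrow> nat" where "letter p = (SOME a. p = page a (tail p))"

lemma page_letter: "p \<in> book \<Longrightarrow> page (letter p) (tail p) = p"
  unfolding letter_def using someI_ex[OF book_page_tail[of p]] by simp

text \<open>
  To go from p to q one goes on the page of p to the hinge point, and from there on the page of q to
  q.  Both halves are journeys in copies of the book, so the recipe can be iterated; \<open>approx n\<close> ends
  the recursion after n steps with straight segments, which leave the book.  As pages contract, the
  approximations converge uniformly, and their limit is the desired path.
\<close>

primrec approx :: "nat \<Rightarrow> bseq \<Rightarrow> bseq \<Rightarrow> real \<Rightarrow> bseq" where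
  "approx 0 p q = linepath p q"
| "approx (Suc n) p q =
    (page (letter p) \<circ> approx n (tail p) hinge) +++ (page (letter q) \<circ> approx n hinge (tail q))"

lemma approx_path:
  "p \<in> book \<Longrightarrow> q \<in> book \<Longrightarrow>
    path (approx n p q) \<and> pathstart (approx n p q) = p \<and> pathfinish (approx n p q) = q"
proof (induction n arbitrary: p q)
  case (Suc n)
  have *: "path (approx n (tail p) hinge)" "pathstart (approx n (tail p) hinge) = tail p"
    "pathfinish (approx n (tail p) hinge) = hinge"
    "path (approx n hinge (tail q))" "pathstart (approx n hinge (tail q)) = hinge"
    "pathfinish (approx n hinge (tail q)) = tail q"
    using Suc.IH[of "tail p" hinge] Suc.IH[of hinge "tail q"] Suc.prems tail_in_book hinge_in_book by simp_all
  have "path (page a \<circ> g)" if "path g" for a g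
    using that by (intro path_continuous_image continuous_on_page continuous_on_id)
  then show ?case using * page_hinge[of "letter p" "letter q"] page_letter Suc.prems
    by (simp add: pathstart_compose pathfinish_compose)
qed simp

lemma approx_norm:
  "p \<in> book \<Longrightarrow> q \<in> book \<Longrightarrow> t \<in> {0..1} \<Longrightarrow> norm (approx n p q t) \<le> 1"
proof (induction n arbitrary: p q t)
  case 0
  have "linepath p q t \<in> closed_segment p q"
    using 0 by (simp add: linepath_in_path)
  moreover have "closed_segment p q \<subseteq> cball 0 1"
    using 0 by (intro closed_segment_subset) (auto simp: book_norm)
  ultimately show ?case by auto
next
  case (Suc n)
  then show ?case
    by (auto simp: joinpaths_def tail_in_book hinge_in_book intro!: norm_page_le Suc.IH)
qed

lemma approx_Cauchy:
  "p \<in> book \<Longrightarrow> q \<in> book \<Longrightarrow> t \<in> {0..1} \<Longrightarrow> 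
    dist (approx n p q t) (approx (n + k) p q t) \<le> 2 * (9/10)^n"
proof (induction n arbitrary: p q t)
  case 0
  have "norm (approx 0 p q t) \<le> 1" "norm (approx (0 + k) p q t) \<le> 1"
    using 0 by (blast intro: approx_norm)+
  then show ?case using norm_triangle_ineq4[of "approx 0 p q t" "approx (0 + k) p q t"]
    by (simp add: dist_norm)
next
  case (Suc n)
  have page: "dist (page a x) (page a y) \<le> 2 * (9/10)^Suc n" if "dist x y \<le> 2 * (9/10)^n" for a x y
    using dist_page_le[of a x y] that by simp
  show ?case
  proof (cases "t \<le> 1/2")
    case True
    then show ?thesis using Suc.prems
      by (auto simp: joinpaths_def tail_in_book hinge_in_book simp del: power_Suc intro!: page Suc.IH)
  next
    case False
    then show ?thesis using Suc.prems
      by (auto simp: joinpaths_def tail_in_book hinge_in_book simp del: power_Suc intro!: page Suc.IH)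
  qed
qed

definition route :: "bseq \<Rightarrow> bseq \<Rightarrow> real \<Rightarrow> bseq" where
  "route p q t = lim (\<lambda>n. approx n p q t)"

lemma approx_uniform_limit:
  assumes "p \<in> book" "q \<in> book"
  shows "uniform_limit {0..1} (\<lambda>n. approx n p q) (route p q) sequentially"
proof -
  have "uniformly_Cauchy_on {0..1} (\<lambda>n. approx n p q)"
  proof (rule uniformly_Cauchy_onI')
    fix e :: real assume "e > 0"
    have "(\<lambda>n. 2 * (9/10)^n) \<longlonglongrightarrow> (0::real)"
      by (intro tendsto_mult_right_zero LIMSEQ_realpow_zero) auto
    then have "\<forall>\<^sub>F n in sequentially. 2 * (9/10)^n < e"
      using \<open>e > 0\<close> by (rule order_tendstoD)
    then obtain M where M: "\<And>n. n \<ge> M \<Longrightarrow> 2 * (9/10)^n < e"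
      unfolding eventually_sequentially by blast
    have "dist (approx m p q t) (approx n p q t) < e" if "t \<in> {0..1}" "m \<ge> M" "n > m" for t m n
      using approx_Cauchy[OF assms that(1), of m "n - m"] M[OF that(2)] that(3) by simp
    then show "\<exists>M. \<forall>x\<in>{0..1}. \<forall>m\<ge>M. \<forall>n>m. dist (approx m p q x) (approx n p q x) < e" by blast
  qed
  then have "uniformly_convergent_on {0..1} (\<lambda>n. approx n p q)"
    by (rule Cauchy_uniformly_convergent)
  then show ?thesis unfolding uniformly_convergent_uniform_limit_iff route_def .
qed

lemma approx_tendsto:
  assumes "p \<in> book" "q \<in> book" "t \<in> {0..1}"
  shows "(\<lambda>n. approx n p q t) \<longlonglongrightarrow> route p q t"
  using tendsto_uniform_limitI[OF approx_uniform_limit[OF assms(1,2)] assms(3)] .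

lemma route_path:
  assumes "p \<in> book" "q \<in> book"
  shows "path (route p q)" "pathstart (route p q) = p" "pathfinish (route p q) = q"
proof -
  show "path (route p q)"
    unfolding path_def
    by (rule uniform_limit_theorem[OF _ approx_uniform_limit[OF assms]])
      (use approx_path[OF assms] in \<open>auto simp: path_def\<close>)
  have "(\<lambda>n. approx n p q 0) \<longlonglongrightarrow> route p q 0" "(\<lambda>n. approx n p q 1) \<longlonglongrightarrow> route p q 1"
    using approx_tendsto[OF assms] by auto
  moreover have "approx n p q 0 = p" "approx n p q 1 = q" for n
    using approx_path[OF assms, of n] by (auto simp: pathstart_def pathfinish_def)
  ultimately show "pathstart (route p q) = p" "pathfinish (route p q) = q"
    unfolding pathstart_def pathfinish_def by (auto intro: LIMSEQ_unique)
qed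

text \<open>
  The limit satisfies the recursion exactly.  It follows that all its points lie in the book, and
  that at most 2^m cells of level m cover it.
\<close>

lemma route_join:
  assumes "p \<in> book" "q \<in> book" "t \<in> {0..1}"
  shows "route p q t =
    ((page (letter p) \<circ> route (tail p) hinge) +++ (page (letter q) \<circ> route hinge (tail q))) t"
proof -
  have page: "(\<lambda>n. page a (X n)) \<longlonglongrightarrow> page a x" if "X \<longlonglongrightarrow> x" for a X x
    by (rule continuous_on_tendsto_compose[OF continuous_on_page[OF continuous_on_id[of UNIV]] that]) auto
  have "(\<lambda>n. approx (Suc n) p q t) \<longlonglongrightarrow>
    ((page (letter p) \<circ> route (tail p) hinge) +++ (page (letter q) \<circ> route hinge (tail q))) t"
    using assms by (auto simp: joinpaths_def intro!: page approx_tendsto tail_in_book hinge_in_book)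
  moreover have "(\<lambda>n. approx (Suc n) p q t) \<longlonglongrightarrow> route p q t"
    using approx_tendsto[OF assms] by (rule LIMSEQ_Suc)
  ultimately show ?thesis using LIMSEQ_unique by blast
qed

lemma route_image:
  assumes "p \<in> book" "q \<in> book"
  shows "path_image (route p q) \<subseteq>
    page (letter p) ` path_image (route (tail p) hinge) \<union> page (letter q) ` path_image (route hinge (tail q))"
proof -
  have "path_image (route p q) =
      path_image ((page (letter p) \<circ> route (tail p) hinge) +++ (page (letter q) \<circ> route hinge (tail q)))"
    unfolding path_image_def by (intro image_cong refl route_join assms)
  then show ?thesis using path_image_join_subset[of "page (letter p) \<circ> route (tail p) hinge"
      "page (letter q) \<circ> route hinge (tail q)"] by (simp add: path_image_compose)
qed

lemma route_in_book:
  assumes "p \<in> book" "q \<in> book"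
  shows "path_image (route p q) \<subseteq> book"
proof
  fix x assume "x \<in> path_image (route p q)"
  then have "x \<in> {x. \<exists>p\<in>book. \<exists>q\<in>book. x \<in> path_image (route p q)}" using assms by blast
  then show "x \<in> book"
  proof (rule book_coinduct)
    fix x assume "x \<in> {x. \<exists>p\<in>book. \<exists>q\<in>book. x \<in> path_image (route p q)}"
    then obtain p q where pq: "p \<in> book" "q \<in> book" "x \<in> path_image (route p q)" by blast
    then obtain t where t: "t \<in> {0..1}" "x = route p q t" by (auto simp: path_image_def)
    have "norm x \<le> 1" unfolding t
      by (rule LIMSEQ_le_const2[OF tendsto_norm[OF approx_tendsto[OF pq(1,2) t(1)]]])
        (intro exI[of _ 0] allI impI approx_norm[OF pq(1,2) t(1)])
    moreover obtain a y where "x = page a y" "y \<in> path_image (route (tail p) hinge) \<or> y \<in> path_image (route hinge (tail q))"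
      using route_image[OF pq(1,2)] pq(3) by blast
    moreover have "tail p \<in> book" "tail q \<in> book" "hinge \<in> book"
      using pq tail_in_book hinge_in_book by auto
    ultimately show "norm x \<le> 1 \<and> (\<exists>a. \<exists>y\<in>{x. \<exists>p\<in>book. \<exists>q\<in>book. x \<in> path_image (route p q)}. x = page a y)"
      by blast
  qed
qed

lemma small_route:
  assumes "p \<in> book" "q \<in> book"
  shows "small (path_image (route p q))"
  unfolding small_def
proof
  fix m
  show "\<exists>W. finite W \<and> (\<forall>w\<in>W. length w = m) \<and> path_image (route p q) \<subseteq> (\<Union>w\<in>W. cell w)"
    using assms
  proof (induction m arbitrary: p q)
    case 0
    then show ?case using route_in_book by (intro exI[of _ "{[]}"]) (simp add: cell_def)
  next
    case (Suc m)
    obtain V where V: "finite V" "\<forall>w\<in>V. length w = m" "path_image (route (tail p) hinge) \<subseteq> (\<Union>w\<in>V. cell w)"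
      using Suc.IH[OF tail_in_book[OF Suc.prems(1)] hinge_in_book] by (elim exE conjE)
    obtain W where W: "finite W" "\<forall>w\<in>W. length w = m" "path_image (route hinge (tail q)) \<subseteq> (\<Union>w\<in>W. cell w)"
      using Suc.IH[OF hinge_in_book tail_in_book[OF Suc.prems(2)]] by (elim exE conjE)
    have "path_image (route p q) \<subseteq> page (letter p) ` (\<Union>w\<in>V. cell w) \<union> page (letter q) ` (\<Union>w\<in>W. cell w)"
      by (rule order_trans[OF route_image[OF Suc.prems] Un_mono[OF image_mono[OF V(3)] image_mono[OF W(3)]]])
    also have "\<dots> = (\<Union>w\<in>(#) (letter p) ` V \<union> (#) (letter q) ` W. cell w)"
      by (simp only: UN_Un cell_Cons image_UN image_image)
    finally show ?case using V W
      by (intro exI[of _ "(#) (letter p) ` V \<union> (#) (letter q) ` W"]) auto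
  qed
qed

section \<open>Avoiding small sets\<close>

definition joined :: "bseq set \<Rightarrow> bseq \<Rightarrow> bseq \<Rightarrow> bool" where
  "joined T p q \<longleftrightarrow> (\<exists>g. path g \<and> pathstart g = p \<and> pathfinish g = q \<and>
      path_image g \<subseteq> book - T \<and> small (path_image g))"

lemma joinedI:
  "path g \<Longrightarrow> pathstart g = p \<Longrightarrow> pathfinish g = q \<Longrightarrow> path_image g \<subseteq> book - T \<Longrightarrow>
    small (path_image g) \<Longrightarrow> joined T p q"
  unfolding joined_def by blast

lemma joined_sym: "joined T p q \<Longrightarrow> joined T q p"
proof -
  assume "joined T p q"
  then obtain g where "path g" "pathstart g = p" "pathfinish g = q" "path_image g \<subseteq> book - T"
    "small (path_image g)"
    unfolding joined_def by blast
  then show ?thesis by (intro joinedI[of "reversepath g"]) auto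
qed

lemma joined_trans:
  assumes "joined T p q" "joined T q r" shows "joined T p r"
proof -
  obtain g where "path g" "pathstart g = p" "pathfinish g = q" "path_image g \<subseteq> book - T"
    "small (path_image g)"
    using assms(1) unfolding joined_def by blast
  moreover obtain h where "path h" "pathstart h = q" "pathfinish h = r" "path_image h \<subseteq> book - T"
    "small (path_image h)"
    using assms(2) unfolding joined_def by blast
  ultimately show ?thesis
    by (intro joinedI[of "g +++ h"]) (simp_all add: path_image_join small_Un)
qed

lemma joined_page:
  assumes "joined (on_page a T) p q" shows "joined T (page a p) (page a q)"
proof -
  obtain g where g: "path g" "pathstart g = p" "pathfinish g = q" "path_image g \<subseteq> book - on_page a T"
    "small (path_image g)"
    using assms unfolding joined_def by blast
  show ?thesis
  proof (rule joinedI[of "page a \<circ> g"])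
    show "path (page a \<circ> g)"
      using g(1) by (intro path_continuous_image continuous_on_page continuous_on_id)
    show "path_image (page a \<circ> g) \<subseteq> book - T"
      using g(4) page_in_book unfolding on_page_def path_image_compose by blast
    show "small (path_image (page a \<circ> g))"
      using g(5) small_page by (simp add: path_image_compose)
  qed (use g in \<open>auto simp: pathstart_compose pathfinish_compose\<close>)
qed

lemma joined_route:
  assumes "p \<in> book" "q \<in> book" "book \<inter> T = {}" shows "joined T p q"
  using assms route_path[OF assms(1,2)] route_in_book[OF assms(1,2)] small_route[OF assms(1,2)]
  by (intro joinedI[of "route p q"]) auto

text \<open>
  Here connecting paths are required to be small, so that they can be avoided in turn.
\<close>

definition avoidable :: "bseq set \<Rightarrow> bool" where
  "avoidable T \<longleftrightarrow> (\<forall>p\<in>book - T. \<forall>q\<in>book - T. joined T p q)"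

lemma avoidableD: "avoidable T \<Longrightarrow> p \<in> book \<Longrightarrow> p \<notin> T \<Longrightarrow> q \<in> book \<Longrightarrow> q \<notin> T \<Longrightarrow> joined T p q"
  unfolding avoidable_def by blast

lemma avoidable_empty: "avoidable {}"
  unfolding avoidable_def using joined_route by blast

lemma inj_page_mark: "inj (\<lambda>d. page d mark)"
proof (rule linorder_injI)
  fix a b :: nat assume "a < b"
  show "page a mark \<noteq> page b mark"
  proof
    assume "page a mark = page b mark"
    then obtain k where "0 < k" "(tail ^^ k) mark = mark"
      using page_eq_mark_depth[OF _ \<open>a < b\<close>] by blast
    then show False using tail_power_mark by simp
  qed
qed

text \<open>
  Used to choose a common point of two pages that avoids a finite set of exceptions.
\<close>

lemma fresh_page_mark:
  assumes "finite F" obtains d where "page d mark \<notin> F"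
proof -
  have "infinite (range (\<lambda>d. page d mark))"
    using inj_page_mark finite_imageD infinite_UNIV_nat by blast
  then have "\<not> range (\<lambda>d. page d mark) \<subseteq> F" using assms finite_subset by blast
  then show ?thesis using that by blast
qed

definition tame :: "bseq set \<Rightarrow> nat \<Rightarrow> bool" where
  "tame T a \<longleftrightarrow> finite (on_page a T) \<and> avoidable (on_page a T)"

text \<open>
  The pages with tame trace are connected off T, and any two of them are connected to each other,
  having infinitely many common points.  It remains to reach them from an arbitrary point p outside
  T.  As T is closed, p lies in a cell that T does not meet, and induction on the word of this cell
  passes from a tame page of a subbook to a tame page of the book containing it.
\<close>

lemma avoidable_if_almost_all_tame:
  assumes closed: "\<And>T. T \<in> \<C> \<Longrightarrow> closed T"
    and on_page: "\<And>T a. T \<in> \<C> \<Longrightarrow> on_page a T \<in> \<C>"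
    and tame: "\<And>T. T \<in> \<C> \<Longrightarrow> finite {a. \<not> tame T a}"
    and T: "T \<in> \<C>"
  shows "avoidable T"
proof -
  have ex_tame: "\<exists>a. tame T a" if "T \<in> \<C>" for T
    using ex_new_if_finite[OF infinite_UNIV_nat tame[OF that]] by blast
  have reach: "\<exists>q\<in>book - on_page a T. joined T p (page a q)"
    if "T \<in> \<C>" "p \<in> cell w" "cell w \<inter> T = {}" "tame T a" for T w p a
    using that
  proof (induction w arbitrary: T p a)
    case Nil
    then have "book \<inter> T = {}" "p \<in> book" by (simp_all add: cell_def)
    then have "mark \<in> book - on_page a T" "joined T p (page a mark)"
      using joined_route[of p "page a mark" T] mark_in_book page_in_book[OF mark_in_book, of a]
      by (auto simp: on_page_def)
    then show ?case by blast
  next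
    case (Cons b w)
    define T' where "T' = on_page b T"
    obtain p' where p': "p = page b p'" "p' \<in> cell w" using Cons.prems(2) by (auto simp: cell_Cons)
    have T': "T' \<in> \<C>" unfolding T'_def by (rule on_page[OF Cons.prems(1)])
    have free: "cell w \<inter> T' = {}"
      using Cons.prems(3) unfolding T'_def on_page_def cell_Cons by blast
    obtain c where c: "tame T' c" using ex_tame[OF T'] by blast
    obtain q where q: "q \<in> book" "q \<notin> on_page c T'" "joined T' p' (page c q)"
      using Cons.IH[OF T' p'(2) free c] by blast
    have "finite (on_page c T' \<union> {r. page c r \<in> on_page a T})"
    proof -
      have "{r. page c r \<in> on_page a T} \<subseteq> tail ` on_page a T"
        using tail_page by (metis (mono_tags, lifting) image_iff mem_Collect_eq subsetI)
      then show ?thesis using c Cons.prems(4) unfolding tame_def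
        by (meson finite_UnI finite_imageI finite_subset)
    qed
    then obtain d where "page d mark \<notin> on_page c T' \<union> {r. page c r \<in> on_page a T}"
      by (rule fresh_page_mark)
    then have d: "page d mark \<notin> on_page c T'" "page c (page d mark) \<notin> on_page a T" by auto
    \<comment> \<open>By the induction hypothesis p reaches subpage c of page b.  From there a common point of this subpage with page a is within reach, since c is tame for page b.\<close>
    have "joined (on_page c T') q (page d mark)"
      using c q d(1) mark_in_book page_in_book unfolding tame_def by (blast intro: avoidableD)
    then have "joined T' (page c q) (page c (page d mark))" by (rule joined_page)
    with q(3) have "joined T' p' (page c (page d mark))" by (rule joined_trans)
    then have "joined T p (page b (page c (page d mark)))"
      unfolding p'(1) T'_def by (rule joined_page)
    then have "joined T p (page a (page c (page d mark)))" by (simp only: portal_glued[of b c d a])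
    moreover have "page c (page d mark) \<in> book" by (intro page_in_book mark_in_book)
    ultimately show ?case using d(2) by blast
  qed
  have free: "\<exists>w. p \<in> cell w \<and> cell w \<inter> T = {}" if p: "p \<in> book - T" for p
  proof -
    obtain e where e: "e > 0" "ball p e \<subseteq> - T"
      using closed[OF T] p open_contains_ball[of "- T"] by auto
    obtain n where "(9/10)^n < e/2"
      using real_arch_pow_inv[of "e/2" "9/10"] e(1) by auto
    then have n: "2 * (9/10)^n < e" by simp
    obtain w where w: "length w = n" "p \<in> cell w" using p book_cell by blast
    have "cell w \<subseteq> ball p e"
    proof
      fix q assume "q \<in> cell w"
      then show "q \<in> ball p e" using cell_dist_le[OF w(2)] w(1) n by fastforce
    qed
    then show ?thesis using e w by blast
  qed
  obtain a where a: "tame T a" using ex_tame[OF T] by blast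
  show ?thesis unfolding avoidable_def
  proof (intro ballI)
    fix p q assume "p \<in> book - T" "q \<in> book - T"
    then obtain p' q' where p': "p' \<in> book - on_page a T" "joined T p (page a p')"
      and q': "q' \<in> book - on_page a T" "joined T q (page a q')"
      using free reach[OF T _ _ a] by meson
    have "joined T (page a p') (page a q')"
      using a p'(1) q'(1) unfolding tame_def by (blast intro: joined_page avoidableD)
    then show "joined T p q"
      by (intro joined_trans[OF joined_trans[OF p'(2)] joined_sym[OF q'(2)]])
  qed
qed

lemma on_page_subset_tail: "on_page a T \<subseteq> tail ` T"
  unfolding on_page_def using tail_page by (metis (mono_tags, lifting) image_eqI mem_Collect_eq subsetI)

lemma finite_on_page: "finite T \<Longrightarrow> finite (on_page a T)"
  using on_page_subset_tail finite_subset by blast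

text \<open>
  A point that no positive iterate of \<open>tail\<close> sends to the mark has a unique address, so T meets
  only finitely many pages.
\<close>

lemma avoidable_finite_no_marks:
  assumes "finite T" "\<And>p k. p \<in> T \<Longrightarrow> k > 0 \<Longrightarrow> (tail ^^ k) p \<noteq> mark"
  shows "avoidable T"
proof (rule avoidable_if_almost_all_tame[where \<C> = "{T. finite T \<and> (\<forall>p\<in>T. \<forall>k>0. (tail ^^ k) p \<noteq> mark)}"])
  fix T a assume T: "T \<in> {T. finite T \<and> (\<forall>p\<in>T. \<forall>k>0. (tail ^^ k) p \<noteq> mark)}"
  then show "closed T" by (auto intro: finite_imp_closed)
  have "(tail ^^ k) p \<noteq> mark" if p: "p \<in> on_page a T" and "k > 0" for p k
  proof -
    have "(tail ^^ Suc k) (page a p) \<noteq> mark" using T p by (simp add: on_page_def del: funpow.simps)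
    then show ?thesis by (simp add: funpow_swap1)
  qed
  then show "on_page a T \<in> {T. finite T \<and> (\<forall>p\<in>T. \<forall>k>0. (tail ^^ k) p \<noteq> mark)}"
    using T finite_on_page by blast
  have "finite {a. page a (tail p) = p}" if "p \<in> T" for p
  proof -
    have "a = b" if ab: "page a (tail p) = p" "page b (tail p) = p" for a b
    proof (rule ccontr)
      assume "a \<noteq> b"
      then obtain k where "0 < k" "(tail ^^ k) (tail p) = mark"
        using page_eq_mark_depth[of a "tail p" b "tail p"] page_eq_mark_depth[of b "tail p" a "tail p"] ab
        by (cases a b rule: linorder_cases) auto
      then have "(tail ^^ Suc k) p = mark" by (simp add: funpow_swap1)
      then show False using T \<open>p \<in> T\<close> by blast
    qed
    then have "{a. page a (tail p) = p} \<subseteq> {SOME a. page a (tail p) = p}"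
      by (auto intro: someI2)
    then show ?thesis by (rule finite_subset) simp
  qed
  then have "finite (\<Union>p\<in>T. {a. page a (tail p) = p})" using T by blast
  moreover have "{a. \<not> tame T a} \<subseteq> (\<Union>p\<in>T. {a. page a (tail p) = p})"
  proof
    fix a assume "a \<in> {a. \<not> tame T a}"
    then have "on_page a T \<noteq> {}" unfolding tame_def using avoidable_empty by auto
    then obtain p where "page a p \<in> T" by (auto simp: on_page_def)
    then show "a \<in> (\<Union>p\<in>T. {a. page a (tail p) = p})" by (intro UN_I[of "page a p"]) simp_all
  qed
  ultimately show "finite {a. \<not> tame T a}" by (rule finite_subset[rotated])
qed (use assms in auto)

text \<open>
  Passing to the trace on a page lowers by one the depth at which points are sent to the mark.
  Induction on the maximal depth K thus makes all pages connected off T, and they are joined through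
  a common point outside T.
\<close>

lemma avoidable_finite:
  assumes "finite T" shows "avoidable T"
proof -
  have *: "avoidable T" if "finite T" "\<And>p k. p \<in> T \<Longrightarrow> (tail ^^ k) p = mark \<Longrightarrow> k \<le> K" for K T
    using that
  proof (induction K arbitrary: T)
    case 0
    show ?case by (rule avoidable_finite_no_marks[OF 0(1)]) (use 0(2) in fastforce)
  next
    case (Suc K)
    have pg: "avoidable (on_page a T)" for a
    proof (rule Suc.IH[OF finite_on_page[OF Suc.prems(1)]])
      fix p k assume "p \<in> on_page a T" "(tail ^^ k) p = mark"
      then have "page a p \<in> T" "(tail ^^ Suc k) (page a p) = mark"
        by (simp_all add: on_page_def funpow_swap1)
      then show "k \<le> K" using Suc.prems(2) by blast
    qed
    obtain d where d: "page d mark \<notin> (tail ^^ 2) ` T"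
      by (rule fresh_page_mark[OF finite_imageI[OF Suc.prems(1)]])
    define r where "r = page 0 (page d mark)"
    have r: "r \<in> book" unfolding r_def by (intro page_in_book mark_in_book)
    have r_off: "r \<notin> on_page a T" for a
    proof
      assume "r \<in> on_page a T"
      then have "(tail ^^ 2) (page a r) \<in> (tail ^^ 2) ` T" unfolding on_page_def by blast
      then show False using d by (simp add: r_def numeral_2_eq_2)
    qed
    have to_r: "joined T p (page 0 r)" if p: "p \<in> book - T" for p
    proof -
      obtain a where a: "p = page a (tail p)" using p book_page_tail by blast
      have "tail p \<in> book" "tail p \<notin> on_page a T"
        using p a tail_in_book by (auto simp: on_page_def)
      then have "joined T (page a (tail p)) (page a r)"
        using pg r r_off by (blast intro: joined_page avoidableD)
      moreover have "page a r = page 0 r" unfolding r_def by (rule portal_glued)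
      ultimately show ?thesis using a by simp
    qed
    show ?case unfolding avoidable_def
      by (intro ballI joined_trans[OF to_r joined_sym[OF to_r]])
  qed
  have "finite {k. (tail ^^ k) p = mark}" for p
  proof -
    have "{k. (tail ^^ k) p = mark} \<subseteq> {SOME k. (tail ^^ k) p = mark}"
      by (auto intro: someI2 mark_depth_unique)
    then show ?thesis by (rule finite_subset) simp
  qed
  then have "finite (\<Union>p\<in>T. {k. (tail ^^ k) p = mark})" using assms by blast
  then obtain K where "\<And>k. k \<in> (\<Union>p\<in>T. {k. (tail ^^ k) p = mark}) \<Longrightarrow> k \<le> K"
    unfolding finite_nat_set_iff_bounded_le by blast
  then show ?thesis using *[OF assms, of K] by blast
qed

lemma closed_on_page: "closed T \<Longrightarrow> closed (on_page a T)"
proof -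
  assume "closed T"
  have "isCont (page a) x" for x
    using continuous_on_page[OF continuous_on_id, of UNIV a]
    by (simp add: continuous_on_eq_continuous_at)
  then have "closed (page a -` T)" using \<open>closed T\<close> by (intro continuous_closed_vimage)
  moreover have "on_page a T = book \<inter> page a -` T" by (auto simp: on_page_def)
  ultimately show ?thesis using closed_book by auto
qed

text \<open>
  If [a] is not among the finitely many words of length 1 whose cells cover T, then T meets page a
  only where this page meets one of those cells.  These points are sent to the mark within a bounded
  number of steps, and a small set contains only finitely many of them.  So the trace is finite and
  can be avoided.
\<close>

lemma avoidable_small:
  assumes "small T" "closed T" shows "avoidable T"
proof (rule avoidable_if_almost_all_tame[where \<C> = "{T. small T \<and> closed T}"])
  fix T a assume T: "T \<in> {T. small T \<and> closed T}"
  then show "closed T" "on_page a T \<in> {T. small T \<and> closed T}"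
    using small_on_page closed_on_page by blast+
  obtain W where W: "finite W" "\<And>w. w \<in> W \<Longrightarrow> length w = 1" "T \<subseteq> (\<Union>w\<in>W. cell w)"
    using T smallD by (metis mem_Collect_eq)
  have "{a. \<not> tame T a} \<subseteq> hd ` W"
  proof
    fix a assume a: "a \<in> {a. \<not> tame T a}"
    show "a \<in> hd ` W"
    proof (rule ccontr)
      assume "a \<notin> hd ` W"
      then have nW: "[a] \<noteq> w" if "w \<in> W" for w using that by force
      have "finite (T \<inter> cell [a] \<inter> cell w)" if w: "w \<in> W" for w
      proof -
        obtain K where K: "\<forall>p \<in> cell [a] \<inter> cell w. \<exists>k\<le>K. (tail ^^ k) p = mark"
          using cells_meet_mark_depth[of "[a]" w] nW[OF w] W(2)[OF w] by auto
        have "finite (\<Union>k\<le>K. {p \<in> T. (tail ^^ k) p = mark})"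
          using T small_imp_finite_marks by blast
        moreover have "T \<inter> cell [a] \<inter> cell w \<subseteq> (\<Union>k\<le>K. {p \<in> T. (tail ^^ k) p = mark})"
          using K by blast
        ultimately show ?thesis by (rule finite_subset[rotated])
      qed
      then have "finite (\<Union>w\<in>W. T \<inter> cell [a] \<inter> cell w)" using W(1) by blast
      moreover have "T \<inter> cell [a] \<subseteq> (\<Union>w\<in>W. T \<inter> cell [a] \<inter> cell w)" using W(3) by blast
      ultimately have "finite (T \<inter> cell [a])" by (rule finite_subset[rotated])
      moreover have "on_page a T \<subseteq> tail ` (T \<inter> cell [a])"
      proof
        fix p assume "p \<in> on_page a T"
        then have "page a p \<in> T \<inter> cell [a]" by (auto simp: on_page_def cell_def)
        then show "p \<in> tail ` (T \<inter> cell [a])" by (metis image_eqI tail_page)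
      qed
      ultimately have "finite (on_page a T)" using finite_surj by blast
      then show False using a avoidable_finite by (simp add: tame_def)
    qed
  qed
  then show "finite {a. \<not> tame T a}" using W(1) finite_surj by blast
qed (use assms in simp)

lemma small_misses_point:
  assumes "small T" obtains d where "page d mark \<notin> T"
proof -
  have "finite {p \<in> T. (tail ^^ 1) p = mark}" by (rule small_imp_finite_marks[OF assms])
  then obtain d where "page d mark \<notin> {p \<in> T. (tail ^^ 1) p = mark}" by (rule fresh_page_mark)
  then show ?thesis using that by simp
qed

lemma joined_in_cell:
  assumes "small T" "closed T" "p \<in> cell w - T" "q \<in> cell w - T"
  obtains g where "path g" "pathstart g = p" "pathfinish g = q" "path_image g \<subseteq> cell w - T"
    "small (path_image g)"
proof -
  have "\<exists>g. path g \<and> pathstart g = p \<and> pathfinish g = q \<and> path_image g \<subseteq> cell w - T \<and> small (path_image g)"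
    using assms
  proof (induction w arbitrary: T p q)
    case Nil
    then have "joined T p q" using avoidable_small avoidableD by (auto simp: cell_def)
    then show ?case unfolding joined_def by (simp add: cell_def)
  next
    case (Cons a w)
    obtain p' q' where pq: "p = page a p'" "p' \<in> cell w" "q = page a q'" "q' \<in> cell w"
      using Cons.prems by (auto simp: cell_Cons)
    have "small (on_page a T)" "closed (on_page a T)"
      using Cons.prems small_on_page closed_on_page by auto
    moreover have "p' \<in> cell w - on_page a T" "q' \<in> cell w - on_page a T"
      using Cons.prems pq by (auto simp: on_page_def)
    ultimately obtain g where g: "path g" "pathstart g = p'" "pathfinish g = q'"
      "path_image g \<subseteq> cell w - on_page a T" "small (path_image g)"
      using Cons.IH by blast
    have "path (page a \<circ> g)"
      using g(1) by (intro path_continuous_image continuous_on_page continuous_on_id)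
    moreover have "path_image (page a \<circ> g) \<subseteq> cell (a # w) - T"
    proof
      fix x assume "x \<in> path_image (page a \<circ> g)"
      then obtain y where y: "x = page a y" "y \<in> cell w" "y \<notin> on_page a T"
        using g(4) unfolding path_image_compose by blast
      then show "x \<in> cell (a # w) - T" using cell_subset_book by (auto simp: on_page_def cell_Cons)
    qed
    moreover have "small (path_image (page a \<circ> g))" using g(5) small_page by (simp add: path_image_compose)
    moreover have "pathstart (page a \<circ> g) = p" "pathfinish (page a \<circ> g) = q"
      using g pq by (auto simp: pathstart_compose pathfinish_compose)
    ultimately show ?case by blast
  qed
  then show ?thesis using that by blast
qed

definition address :: "bseq \<Rightarrow> nat \<Rightarrow> nat list" where
  "address x n = map (\<lambda>i. letter ((tail ^^ i) x)) [0..<n]"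

lemma length_address [simp]: "length (address x n) = n" by (simp add: address_def)

lemma address_Suc: "address x (Suc n) = address x n @ [letter ((tail ^^ n) x)]"
  by (simp add: address_def)

lemma pages_address: "x \<in> book \<Longrightarrow> pages (address x n) ((tail ^^ n) x) = x"
proof (induction n)
  case 0 then show ?case by (simp add: address_def)
next
  case (Suc n)
  have "page (letter ((tail ^^ n) x)) ((tail ^^ Suc n) x) = (tail ^^ n) x"
    using page_letter[OF tail_power_in_book[OF Suc.prems]] by simp
  then show ?case using Suc unfolding address_Suc by (simp add: pages_append del: funpow.simps)
qed

lemma cell_append_subset: "cell (v @ w) \<subseteq> cell v"
  using pages_in_book unfolding cell_def pages_append by auto

lemma cell_address_antimono: "n \<le> m \<Longrightarrow> cell (address x m) \<subseteq> cell (address x n)"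
proof (induction m rule: dec_induct)
  case (step m)
  then show ?case using cell_append_subset unfolding address_Suc by blast
qed simp

lemma in_cell_address: "x \<in> book \<Longrightarrow> x \<in> cell (address x n)"
  using pages_address[of x n] tail_power_in_book[of x n] unfolding cell_def by (metis image_eqI)

text \<open>
  Choose points u n outside T in the cells around x, with u (n+1) in the same cell of level n as
  u n, and join consecutive ones inside these cells off T.
\<close>

lemma accessible:
  assumes T: "small T" "closed T" and x: "x \<in> book" and y: "y \<in> book - T"
  obtains g where "path g" "pathstart g = y" "pathfinish g = x"
    "path_image g \<subseteq> insert x (book - T)" "small (path_image g)"
proof -
  have "\<exists>u. u \<in> cell (address x n) - T" for n
  proof -
    have "\<exists>u. u \<in> cell w - T" for w using T(1)
    proof (induction w arbitrary: T)
      case Nil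
      then obtain d where "page d mark \<notin> T" by (rule small_misses_point)
      then show ?case using mark_in_book page_in_book by (intro exI[of _ "page d mark"]) (simp add: cell_def)
    next
      case (Cons a w)
      obtain u where "u \<in> cell w - on_page a T" using Cons.IH[OF small_on_page[OF Cons.prems]] by blast
      then have "page a u \<in> cell (a # w) - T" using cell_subset_book by (auto simp: on_page_def cell_Cons)
      then show ?case by blast
    qed
    then show ?thesis .
  qed
  then obtain u where u: "\<And>n. u n \<in> cell (address x n) - T" by metis
  have "\<exists>g. path g \<and> pathstart g = u n \<and> pathfinish g = u (Suc n) \<and>
      path_image g \<subseteq> cell (address x n) - T \<and> small (path_image g)" for n
  proof -
    have "u (Suc n) \<in> cell (address x n) - T"
      using u[of "Suc n"] cell_address_antimono[of n "Suc n" x] by auto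
    then show ?thesis using joined_in_cell[OF T u[of n]] by metis
  qed
  then obtain \<gamma> where \<gamma>: "\<And>n. path (\<gamma> n)" "\<And>n. pathstart (\<gamma> n) = u n" "\<And>n. pathfinish (\<gamma> n) = u (Suc n)"
    "\<And>n. path_image (\<gamma> n) \<subseteq> cell (address x n) - T" "\<And>n. small (path_image (\<gamma> n))"
    by metis
  obtain h where h: "path h" "pathstart h = pathstart (\<gamma> 0)" "pathfinish h = x"
    "path_image h \<subseteq> insert x (\<Union>n. path_image (\<gamma> n))"
  proof (rule path_infinite_join[of \<gamma> x])
    fix e :: real assume "e > 0"
    then obtain N where "(9/10)^N < e/2"
      using real_arch_pow_inv[of "e/2" "9/10"] by auto
    then have N: "2 * (9/10)^N < e" by simp
    have "path_image (\<gamma> n) \<subseteq> ball x e" if "n \<ge> N" for n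
    proof
      fix p assume "p \<in> path_image (\<gamma> n)"
      then have "p \<in> cell (address x N)" using \<gamma>(4) cell_address_antimono[OF that] by blast
      then have "dist x p \<le> 2 * (9/10)^N" using cell_dist_le[OF in_cell_address[OF x]] by fastforce
      then show "p \<in> ball x e" using N by simp
    qed
    then show "\<exists>N. \<forall>n\<ge>N. path_image (\<gamma> n) \<subseteq> ball x e" by blast
  qed (use \<gamma> in auto)
  have small_h: "small (path_image h)"
    unfolding small_def
  proof
    fix m
    \<comment> \<open>Beyond the first m pieces, the path stays in one cell of level m.\<close>
    have small_init: "small (\<Union>n<m. path_image (\<gamma> n))" for m
      by (induction m) (auto simp: lessThan_Suc intro: small_Un \<gamma>(5))
    then obtain W where W: "finite W" "\<And>w. w \<in> W \<Longrightarrow> length w = m" "(\<Union>n<m. path_image (\<gamma> n)) \<subseteq> (\<Union>w\<in>W. cell w)"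
      using smallD[OF small_init[of m], of m] by blast
    have cover: "path_image (\<gamma> n) \<subseteq> (\<Union>w\<in>insert (address x m) W. cell w)" for n
    proof (cases "n < m")
      case True then show ?thesis using W(3) by blast
    next
      case False
      then show ?thesis using \<gamma>(4)[of n] cell_address_antimono[of m n x] by auto
    qed
    have "x \<in> (\<Union>w\<in>insert (address x m) W. cell w)"
      using in_cell_address[OF x, of m] by simp
    then have "path_image h \<subseteq> (\<Union>w\<in>insert (address x m) W. cell w)"
      by (intro order_trans[OF h(4)] insert_subsetI UN_least cover)
    then show "\<exists>W. finite W \<and> (\<forall>w\<in>W. length w = m) \<and> path_image h \<subseteq> (\<Union>w\<in>W. cell w)"
      using W by (intro exI[of _ "insert (address x m) W"]) auto
  qed
  have "path_image (\<gamma> n) \<subseteq> book - T" for n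
    by (rule order_trans[OF \<gamma>(4) Diff_mono[OF cell_subset_book order_refl]])
  then have image_h: "path_image h \<subseteq> insert x (book - T)"
    by (intro order_trans[OF h(4)] insert_mono UN_least)
  have "u 0 \<in> book - T" using u[of 0] cell_subset_book by blast
  then have "joined T y (u 0)" using avoidable_small[OF T] y avoidableD by blast
  then obtain f where f: "path f" "pathstart f = y" "pathfinish f = u 0" "path_image f \<subseteq> book - T"
    "small (path_image f)"
    unfolding joined_def by blast
  show ?thesis
  proof (rule that[of "f +++ h"])
    show "path (f +++ h)" "pathstart (f +++ h) = y" "pathfinish (f +++ h) = x"
      using f h \<gamma>(2) by auto
    have "path_image (f +++ h) = path_image f \<union> path_image h"
      using f h \<gamma>(2) by (intro path_image_join) auto
    then show "path_image (f +++ h) \<subseteq> insert x (book - T)" "small (path_image (f +++ h))"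
      using f image_h small_h small_Un by auto
  qed
qed

lemma path_meeting_only_at_ends:
  assumes T: "small T" "closed T" and xy: "x \<in> book" "y \<in> book"
  obtains g where "path g" "pathstart g = x" "pathfinish g = y"
    "path_image g \<subseteq> book" "path_image g \<inter> T \<subseteq> {x, y}" "small (path_image g)"
proof -
  obtain d where "page d mark \<notin> T" using small_misses_point[OF T(1)] .
  then have z: "page d mark \<in> book - T" using mark_in_book page_in_book by blast
  obtain f where f: "path f" "pathstart f = page d mark" "pathfinish f = x"
    "path_image f \<subseteq> insert x (book - T)" "small (path_image f)"
    using accessible[OF T xy(1) z] .
  obtain g where g: "path g" "pathstart g = page d mark" "pathfinish g = y"
    "path_image g \<subseteq> insert y (book - T)" "small (path_image g)"
    using accessible[OF T xy(2) z] .
  show ?thesis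
  proof (rule that[of "reversepath f +++ g"])
    have im: "path_image (reversepath f +++ g) = path_image f \<union> path_image g"
      using f g by (subst path_image_join) auto
    show "path_image (reversepath f +++ g) \<subseteq> book" "path_image (reversepath f +++ g) \<inter> T \<subseteq> {x, y}"
      unfolding im using f(4) g(4) xy by blast+
    show "small (path_image (reversepath f +++ g))" unfolding im using f(5) g(5) by (rule small_Un)
  qed (use f g in auto)
qed

section \<open>Arcs through prescribed points\<close>

text \<open>
  Induction on the number m of points already joined.  The arc is kept small and away from the points
  still to come, so that both together can be avoided by the next path except at its ends.
\<close>

lemma arc_through_points:
  fixes m n :: nat
  assumes "2 \<le> m" "m \<le> n" and x: "x ` {1..n} \<subseteq> book" "inj_on x {1..n}"
  shows "\<exists>g t. arc g \<and> path_image g \<subseteq> book \<and> small (path_image g) \<and> pathfinish g = x m \<and>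
    strict_mono_on {1..m} t \<and> t ` {1..m} \<subseteq> {0..1::real} \<and> (\<forall>i\<in>{1..m}. g (t i) = x i) \<and>
    (\<forall>i\<in>{m<..n}. x i \<notin> path_image g)"
  using assms(1,2)
proof (induction m rule: dec_induct)
  case base
  have T: "small (x ` {3..n})" "closed (x ` {3..n})"
    using x(1) by (auto intro!: small_finite finite_imp_closed)
  have xb: "x 1 \<in> book" "x 2 \<in> book" using x(1) base by auto
  obtain p where p: "path p" "pathstart p = x 1" "pathfinish p = x 2" "path_image p \<subseteq> book"
    "path_image p \<inter> x ` {3..n} \<subseteq> {x 1, x 2}" "small (path_image p)"
    using path_meeting_only_at_ends[OF T xb] .
  have ne: "x 1 \<noteq> x 2" using inj_onD[OF x(2), of 1 2] base by auto
  obtain g where g: "arc g" "path_image g \<subseteq> path_image p" "pathstart g = x 1" "pathfinish g = x 2"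
    using path_contains_arc[OF p(1-3) ne] .
  define t :: "nat \<Rightarrow> real" where "t i = (if i \<le> 1 then 0 else 1)" for i
  have "x i \<notin> path_image g" if i: "i \<in> {2<..n}" for i
  proof
    assume "x i \<in> path_image g"
    then have "x i \<in> {x 1, x 2}" using g(2) p(5) i by auto
    then show False using inj_onD[OF x(2), of i 1] inj_onD[OF x(2), of i 2] i by auto
  qed
  moreover have "strict_mono_on {1..2} t" by (auto simp: strict_mono_on_def t_def)
  moreover have "t ` {1..2} \<subseteq> {0..1}" by (auto simp: t_def)
  moreover have "\<forall>i\<in>{1..2}. g (t i) = x i"
  proof
    fix i :: nat assume "i \<in> {1..2}"
    then have "i = 1 \<or> i = 2" by auto
    then show "g (t i) = x i" using g(3,4) by (auto simp: t_def pathstart_def pathfinish_def)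
  qed
  moreover have "path_image g \<subseteq> book" "small (path_image g)"
    using g(2) p(4,6) small_subset by blast+
  ultimately show ?case using g(1,4) by (intro exI[of _ g] exI[of _ t] conjI) auto
next
  case (step m)
  then obtain g t where g: "arc g" "path_image g \<subseteq> book" "small (path_image g)" "pathfinish g = x m"
    and t: "strict_mono_on {1..m} t" "t ` {1..m} \<subseteq> {0..1::real}" "\<And>i. i\<in>{1..m} \<Longrightarrow> g (t i) = x i"
    and off: "\<And>i. i\<in>{m<..n} \<Longrightarrow> x i \<notin> path_image g"
    using Suc_leD by blast
  let ?T = "path_image g \<union> x ` {Suc m<..n}"
  have "small (x ` {Suc m<..n})" using x(1) by (intro small_finite) auto
  then have T: "small ?T" "closed ?T"
    using g(1,3) by (auto intro!: small_Un closed_Un closed_arc_image intro: finite_imp_closed)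
  have xb: "x m \<in> book" "x (Suc m) \<in> book" using x(1) step.prems step.hyps by auto
  obtain p where p: "path p" "pathstart p = x m" "pathfinish p = x (Suc m)" "path_image p \<subseteq> book"
    "path_image p \<inter> ?T \<subseteq> {x m, x (Suc m)}" "small (path_image p)"
    using path_meeting_only_at_ends[OF T xb] .
  have ne: "x m \<noteq> x (Suc m)" using inj_onD[OF x(2), of m "Suc m"] step.prems step.hyps by auto
  obtain h where h: "arc h" "path_image h \<subseteq> path_image p" "pathstart h = x m" "pathfinish h = x (Suc m)"
    using path_contains_arc[OF p(1-3) ne] .
  have "x (Suc m) \<notin> path_image g" using off[of "Suc m"] step.prems by simp
  then have "path_image g \<inter> path_image h \<subseteq> {pathstart h}" using h(2,3) p(5) by auto
  then have arc: "arc (g +++ h)" using g(1,4) h(1,3) by (intro arc_join) auto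
  have im: "path_image (g +++ h) = path_image g \<union> path_image h"
    using g(4) h(3) by (intro path_image_join) auto
  define t' where "t' i = (if i \<le> m then t i / 2 else 1)" for i
  have t01: "0 \<le> t i \<and> t i \<le> 1" if "i \<in> {1..m}" for i using t(2) that by (simp add: image_subset_iff)
  have "strict_mono_on {1..Suc m} t'"
  proof (rule strict_mono_onI)
    fix i j assume ij: "i \<in> {1..Suc m}" "j \<in> {1..Suc m}" "i < j"
    then have i: "i \<in> {1..m}" by auto
    show "t' i < t' j"
    proof (cases "j \<le> m")
      case True
      then show ?thesis using ij strict_mono_onD[OF t(1) i, of j] by (simp add: t'_def)
    next
      case False
      then show ?thesis using t01[OF i] i by (simp add: t'_def)
    qed
  qed
  moreover have "t' ` {1..Suc m} \<subseteq> {0..1}"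
    using t01 by (force simp: t'_def)
  moreover have "\<forall>i\<in>{1..Suc m}. (g +++ h) (t' i) = x i"
  proof
    fix i assume i: "i \<in> {1..Suc m}"
    show "(g +++ h) (t' i) = x i"
    proof (cases "i \<le> m")
      case True
      then show ?thesis using i t01[of i] t(3)[of i] by (simp add: t'_def joinpaths_def)
    next
      case False
      then have "i = Suc m" using i by simp
      then show ?thesis using h(4) by (simp add: t'_def joinpaths_def pathfinish_def)
    qed
  qed
  moreover have "\<forall>i\<in>{Suc m<..n}. x i \<notin> path_image (g +++ h)"
  proof
    fix i assume i: "i \<in> {Suc m<..n}"
    have "x i \<notin> path_image h"
    proof
      assume "x i \<in> path_image h"
      then have "x i \<in> {x m, x (Suc m)}" using h(2) p(5) i by auto
      then show False using inj_onD[OF x(2), of i m] inj_onD[OF x(2), of i "Suc m"] i step.hyps by auto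
    qed
    then show "x i \<notin> path_image (g +++ h)" unfolding im using off[of i] i by auto
  qed
  moreover have "path_image (g +++ h) \<subseteq> book" "small (path_image (g +++ h))"
    unfolding im using g(2,3) h(2) p(4,6) small_subset small_Un by blast+
  ultimately show ?case using arc h(4) by (intro exI[of _ "g +++ h"] exI[of _ t'] conjI) auto
qed

lemma arc_imp_arc_in:
  fixes g :: "real \<Rightarrow> 'a::metric_space"
  assumes "arc g" "path_image g \<subseteq> S"
  shows "arc_in (top_of_set S) g"
  unfolding arc_in_def
proof (rule continuous_imp_embedding_map)
  show "continuous_map (top_of_set {0..1}) (top_of_set S) g"
    using assms by (auto simp: arc_def path_def path_image_def)
  show "inj_on g (topspace (top_of_set {0..1}))"
    using assms by (simp add: arc_def)
  show "compact_space (top_of_set {0..1::real})" by (simp add: compact_space_subtopology)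
  show "Hausdorff_space (top_of_set S)" by (intro Hausdorff_space_subtopology Hausdorff_space_euclidean)
qed

lemma omega_sac_book: "omega_sac (top_of_set book)"
  unfolding omega_sac_def n_sac_def
proof (intro allI impI)
  fix n :: nat and x :: "nat \<Rightarrow> bseq"
  assume n: "n \<ge> 2" and x: "x ` {1..n} \<subseteq> topspace (top_of_set book) \<and> inj_on x {1..n}"
  then obtain g t where "arc g" "path_image g \<subseteq> book" "strict_mono_on {1..n} t" "t ` {1..n} \<subseteq> {0..1::real}"
    "\<forall>i\<in>{1..n}. g (t i) = x i"
    using arc_through_points[of n n x] by auto
  then show "\<exists>\<alpha> t. arc_in (top_of_set book) \<alpha> \<and> t ` {1..n} \<subseteq> {0..1} \<and> strict_mono_on {1..n} t \<and>
      (\<forall>i\<in>{1..n}. \<alpha> (t i) = x i)"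
    using arc_imp_arc_in by blast
qed

section \<open>Compactness and local connectedness\<close>

text \<open>
  Finite covers by sets of arbitrarily small diameter, here and in the next lemma also connected
  ones, are known as property S.
\<close>

lemma property_S_imp_compact:
  fixes S :: "'a::complete_space set"
  assumes "closed S"
    and cover: "\<And>e. e > 0 \<Longrightarrow> \<exists>\<N>. finite \<N> \<and> \<Union>\<N> = S \<and> (\<forall>N\<in>\<N>. \<forall>x\<in>N. \<forall>y\<in>N. dist x y < e)"
  shows "compact S"
  unfolding compact_eq_totally_bounded
proof (intro conjI allI impI)
  show "complete S" using \<open>closed S\<close> by (simp add: complete_eq_closed)
  fix e :: real assume "e > 0"
  then obtain \<N> where \<N>: "finite \<N>" "\<Union>\<N> = S" "\<And>N x y. N \<in> \<N> \<Longrightarrow> x \<in> N \<Longrightarrow> y \<in> N \<Longrightarrow> dist x y < e"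
    using cover by meson
  have "S \<subseteq> (\<Union>x\<in>(\<lambda>N. SOME x. x \<in> N) ` \<N>. ball x e)"
  proof
    fix y assume "y \<in> S"
    then obtain N where N: "N \<in> \<N>" "y \<in> N" using \<N>(2) by blast
    then have "(SOME x. x \<in> N) \<in> N" by (metis someI)
    then have "y \<in> ball (SOME x. x \<in> N) e" using \<N>(3) N by simp
    then show "y \<in> (\<Union>x\<in>(\<lambda>N. SOME x. x \<in> N) ` \<N>. ball x e)" using N(1) by blast
  qed
  then show "\<exists>k. finite k \<and> S \<subseteq> (\<Union>x\<in>k. ball x e)"
    using \<N>(1) by (intro exI[of _ "(\<lambda>N. SOME x. x \<in> N) ` \<N>"]) simp
qed

text \<open>
  For a fine cover the members that contain x form a neighbourhood of x, since the union of the
  finitely many others is closed.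
\<close>

lemma property_S_imp_locally_connected:
  fixes S :: "'a::metric_space set"
  assumes cover: "\<And>e. e > 0 \<Longrightarrow> \<exists>\<N>. finite \<N> \<and> \<Union>\<N> = S \<and>
      (\<forall>N\<in>\<N>. closed N \<and> connected N \<and> (\<forall>x\<in>N. \<forall>y\<in>N. dist x y < e))"
  shows "locally_connected_space (top_of_set S)"
  unfolding locally_connected_space_im_kleinen
proof (intro allI impI, elim conjE)
  fix V x assume V: "openin (top_of_set S) V" and x: "x \<in> V"
  then have VS: "V \<subseteq> S" by (simp add: openin_imp_subset)
  obtain e where e: "e > 0" "\<And>y. y \<in> S \<Longrightarrow> dist y x < e \<Longrightarrow> y \<in> V"
    using V x unfolding openin_euclidean_subtopology_iff by blast
  obtain \<N> where fin: "finite \<N>" "\<Union>\<N> = S"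
    and "\<forall>N\<in>\<N>. closed N \<and> connected N \<and> (\<forall>x\<in>N. \<forall>y\<in>N. dist x y < e)"
    using cover[OF e(1)] by (elim exE conjE)
  then have \<N>: "finite \<N>" "\<Union>\<N> = S" "\<And>N. N \<in> \<N> \<Longrightarrow> closed N" "\<And>N. N \<in> \<N> \<Longrightarrow> connected N"
    "\<And>N x y. N \<in> \<N> \<Longrightarrow> x \<in> N \<Longrightarrow> y \<in> N \<Longrightarrow> dist x y < e"
    by simp_all
  have small: "N \<subseteq> V" if "N \<in> \<N>" "x \<in> N" for N
    using that \<N>(2,5) e(2) by blast
  define U where "U = S - \<Union>{N \<in> \<N>. x \<notin> N}"
  have "closed (\<Union>{N \<in> \<N>. x \<notin> N})" using \<N>(1,3) by (intro closed_Union) auto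
  then have "openin (top_of_set S) U" unfolding U_def Diff_eq
    by (intro openin_open_Int open_Compl)
  moreover have "x \<in> U" using x VS by (auto simp: U_def)
  moreover have UN: "\<exists>N\<in>\<N>. x \<in> N \<and> y \<in> N" if "y \<in> U" for y
    using that \<N>(2) unfolding U_def by blast
  moreover have "U \<subseteq> V" using UN small by blast
  moreover have "\<forall>y\<in>U. \<exists>C. connectedin (top_of_set S) C \<and> C \<subseteq> V \<and> x \<in> C \<and> y \<in> C"
  proof
    fix y assume "y \<in> U"
    then obtain N where N: "N \<in> \<N>" "x \<in> N" "y \<in> N" using UN by blast
    have "connectedin (top_of_set S) N"
      using \<N>(2,4) N(1) by (auto simp: connectedin_subtopology)
    then show "\<exists>C. connectedin (top_of_set S) C \<and> C \<subseteq> V \<and> x \<in> C \<and> y \<in> C"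
      using N small by blast
  qed
  ultimately show "\<exists>U. openin (top_of_set S) U \<and> x \<in> U \<and> U \<subseteq> V \<and>
      (\<forall>y\<in>U. \<exists>C. connectedin (top_of_set S) C \<and> C \<subseteq> V \<and> x \<in> C \<and> y \<in> C)" by blast
qed

lemma connected_book: "connected book"
proof (rule path_connected_imp_connected)
  show "path_connected book" unfolding path_connected_def
  proof (intro ballI)
    fix p q assume "p \<in> book" "q \<in> book"
    then show "\<exists>g. path g \<and> path_image g \<subseteq> book \<and> pathstart g = p \<and> pathfinish g = q"
      by (intro exI[of _ "route p q"] conjI route_path route_in_book)
  qed
qed

text \<open>
  The cell inside the piece is what guarantees that late pages over the piece touch page 0.
\<close>

definition fine_piece :: "nat \<Rightarrow> bseq set \<Rightarrow> bool" where
  "fine_piece m N \<longleftrightarrow> closed N \<and> connected N \<and> N \<subseteq> book \<and> (\<exists>w. length w = m \<and> cell w \<subseteq> N) \<and>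
     (\<forall>x\<in>N. \<forall>y\<in>N. dist x y \<le> 2 * (9/10)^m)"

lemma fine_piece_page: "fine_piece m N \<Longrightarrow> fine_piece (Suc m) (page b ` N)"
proof -
  assume N: "fine_piece m N"
  then obtain w where w: "length w = m" "cell w \<subseteq> N" unfolding fine_piece_def by blast
  show ?thesis unfolding fine_piece_def
  proof (intro conjI ballI)
    show "closed (page b ` N)" using N closed_page_image unfolding fine_piece_def by blast
    show "connected (page b ` N)"
      using N unfolding fine_piece_def
      by (intro connected_continuous_image continuous_on_page continuous_on_id) blast
    show "page b ` N \<subseteq> book" using N page_in_book unfolding fine_piece_def by blast
    show "\<exists>w. length w = Suc m \<and> cell w \<subseteq> page b ` N"
      using w by (intro exI[of _ "b # w"]) (auto simp: cell_Cons)
    fix x y assume "x \<in> page b ` N" "y \<in> page b ` N"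
    then obtain x' y' where xy: "x = page b x'" "y = page b y'" "x' \<in> N" "y' \<in> N" by blast
    then have "dist x' y' \<le> 2 * (9/10)^m" using N unfolding fine_piece_def by blast
    then show "dist x y \<le> 2 * (9/10)^Suc m"
      using dist_page_le[of b x' y'] unfolding xy by simp
  qed
qed

text \<open>
  All pages after page m + 1 touch page 0 over the same point z of a cell of level m in N.  Together
  they are connected, and they are low enough not to spoil the diameter.
\<close>

lemma fine_piece_many_pages:
  assumes N: "fine_piece m N"
  shows "fine_piece (Suc m) (\<Union>b\<in>insert 0 {Suc m<..}. page b ` N)" (is "fine_piece _ ?N")
proof -
  obtain w where w: "length w = m" "cell w \<subseteq> N" using N unfolding fine_piece_def by blast
  define z where "z = pages w (page 0 (page 0 mark))"
  have "(tail ^^ m) z = page 0 (page 0 mark)" using w(1) tail_pages[of w] unfolding z_def by auto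
  then have z: "(tail ^^ (m + 2)) z = mark" by simp
  have "z \<in> cell w" unfolding z_def cell_def by (intro imageI page_in_book mark_in_book)
  then have zN: "z \<in> N" using w(2) by blast
  have glued: "page b z = page 0 z" if "b \<in> insert 0 {Suc m<..}" for b
    using that page_glued[OF z, of b] by auto
  show ?thesis unfolding fine_piece_def
  proof (intro conjI ballI)
    show "closed ?N" using N unfolding fine_piece_def by (intro closed_pages) auto
    show "connected ?N"
    proof (rule connected_Union)
      show "connected s" if "s \<in> (\<lambda>b. page b ` N) ` insert 0 {Suc m<..}" for s
        using that fine_piece_page[OF N] unfolding fine_piece_def by blast
      have "page 0 z \<in> \<Inter>((\<lambda>b. page b ` N) ` insert 0 {Suc m<..})"
      proof (rule InterI)
        fix s assume "s \<in> (\<lambda>b. page b ` N) ` insert 0 {Suc m<..}"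
        then obtain b where "b \<in> insert 0 {Suc m<..}" "s = page b ` N" by blast
        then show "page 0 z \<in> s" using glued[of b] zN by (metis image_eqI)
      qed
      then show "\<Inter>((\<lambda>b. page b ` N) ` insert 0 {Suc m<..}) \<noteq> {}" by blast
    qed
    show "?N \<subseteq> book" using N page_in_book unfolding fine_piece_def by blast
    show "\<exists>w. length w = Suc m \<and> cell w \<subseteq> ?N"
      using w by (intro exI[of _ "0 # w"]) (auto simp: cell_Cons)
    fix x y assume "x \<in> ?N" "y \<in> ?N"
    then obtain a x' b y' where xy: "x = page a x'" "y = page b y'" "x' \<in> N" "y' \<in> N"
      "a \<in> insert 0 {Suc m<..}" "b \<in> insert 0 {Suc m<..}" by blast
    have "dist x' y' \<le> 2 * (9/10)^m" using N xy unfolding fine_piece_def by blast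
    then have 1: "9/10 * dist x' y' \<le> 2 * (9/10)^Suc m" by simp
    have off: "\<bar>offset c * glue c q\<bar> \<le> (9/10)^Suc m" if "c \<in> insert 0 {Suc m<..}" for c q
    proof (cases c)
      case (Suc n)
      then have "\<bar>offset c\<bar> \<le> (1/2)^Suc m" using that abs_offset_le[of "Suc m" n] by auto
      also have "\<dots> \<le> (9/10)^Suc m" by (rule power_mono) auto
      finally have "\<bar>offset c\<bar> * \<bar>glue c q\<bar> \<le> (9/10)^Suc m * 1"
        using glue_range[of c q] by (intro mult_mono) auto
      then show ?thesis by (simp add: abs_mult)
    qed simp
    have "\<bar>offset a * glue a x' - offset b * glue b y'\<bar> \<le> 2 * (9/10)^Suc m"
      using off[OF xy(5), of x'] off[OF xy(6), of y'] by linarith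
    with 1 show "dist x y \<le> 2 * (9/10)^Suc m"
      unfolding xy(1,2) page_def by (intro order_trans[OF dist_prepend_le] max.boundedI)
  qed
qed

text \<open>
  Over each piece of the cover of level m the first m + 2 pages are taken separately, and
  page 0 together with all the others as a single piece.
\<close>

lemma fine_cover: "\<exists>\<N>. finite \<N> \<and> \<Union>\<N> = book \<and> (\<forall>N\<in>\<N>. fine_piece m N)"
proof (induction m)
  case 0
  have "fine_piece 0 book"
    unfolding fine_piece_def using closed_book connected_book book_dist_le by (simp add: cell_def)
  then show ?case by (intro exI[of _ "{book}"]) simp
next
  case (Suc m)
  then obtain \<N> where \<N>: "finite \<N>" "\<Union>\<N> = book" "\<And>N. N \<in> \<N> \<Longrightarrow> fine_piece m N" by blast
  define \<A> where "\<A> = (\<lambda>(b, N). page b ` N) ` ({..Suc m} \<times> \<N>)"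
  define \<B> where "\<B> = (\<lambda>N. \<Union>b\<in>insert 0 {Suc m<..}. page b ` N) ` \<N>"
  have "finite (\<A> \<union> \<B>)" using \<N>(1) by (simp add: \<A>_def \<B>_def)
  moreover have fine: "\<forall>N\<in>\<A> \<union> \<B>. fine_piece (Suc m) N"
    using \<N>(3) fine_piece_page fine_piece_many_pages by (auto simp: \<A>_def \<B>_def)
  moreover have "\<Union>(\<A> \<union> \<B>) = book"
  proof
    show "\<Union>(\<A> \<union> \<B>) \<subseteq> book" using fine unfolding fine_piece_def by blast
    show "book \<subseteq> \<Union>(\<A> \<union> \<B>)"
    proof
      fix p assume p: "p \<in> book"
      then obtain b where b: "p = page b (tail p)" using book_page_tail by blast
      obtain N where N: "N \<in> \<N>" "tail p \<in> N" using tail_in_book[OF p] \<N>(2) by blast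
      then have pN: "p \<in> page b ` N" using b by blast
      show "p \<in> \<Union>(\<A> \<union> \<B>)"
      proof (cases "b \<le> Suc m")
        case True
        then have "page b ` N \<in> \<A>" using N(1) unfolding \<A>_def by force
        then show ?thesis using pN by blast
      next
        case False
        then have "p \<in> (\<Union>b\<in>insert 0 {Suc m<..}. page b ` N)" using pN by auto
        then show ?thesis using N(1) unfolding \<B>_def by blast
      qed
    qed
  qed
  ultimately show ?case by blast
qed

lemma book_property_S:
  assumes "e > 0"
  shows "\<exists>\<N>. finite \<N> \<and> \<Union>\<N> = book \<and>
    (\<forall>N\<in>\<N>. closed N \<and> connected N \<and> (\<forall>x\<in>N. \<forall>y\<in>N. dist x y < e))"
proof -
  obtain m where "(9/10)^m < e/2" using real_arch_pow_inv[of "e/2" "9/10"] assms by auto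
  then have m: "2 * (9/10)^m < e" by simp
  obtain \<N> where \<N>: "finite \<N>" "\<Union>\<N> = book" "\<And>N. N \<in> \<N> \<Longrightarrow> fine_piece m N"
    using fine_cover[of m] by blast
  have "closed N \<and> connected N \<and> (\<forall>x\<in>N. \<forall>y\<in>N. dist x y < e)" if "N \<in> \<N>" for N
    using \<N>(3)[OF that] m unfolding fine_piece_def by (meson le_less_trans)
  then show ?thesis using \<N>(1,2) by blast
qed

lemma compact_book: "compact book"
proof (rule property_S_imp_compact[OF closed_book])
  fix e :: real assume "e > 0"
  from book_property_S[OF this]
  show "\<exists>\<N>. finite \<N> \<and> \<Union>\<N> = book \<and> (\<forall>N\<in>\<N>. \<forall>x\<in>N. \<forall>y\<in>N. dist x y < e)"
    by (elim ex_forward conj_forward ballI) simp_all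
qed

lemma locally_connected_book: "locally_connected_space (top_of_set book)"
  by (rule property_S_imp_locally_connected[OF book_property_S])

section \<open>Rationality\<close>

text \<open>
  By compactness finite intersections of the separating sets V form a base at p; the frontier of a
  finite intersection lies in the union of the frontiers.
\<close>

lemma rational_spaceI:
  assumes compact: "compact_space X"
    and separate: "\<And>p q. p \<in> topspace X \<Longrightarrow> q \<in> topspace X \<Longrightarrow> p \<noteq> q \<Longrightarrow>
      \<exists>V W. openin X V \<and> openin X W \<and> p \<in> V \<and> q \<in> W \<and> V \<inter> W = {} \<and> countable (X frontier_of V)"
  shows "rational_space X"
  unfolding rational_space_def base_of_def
proof (intro exI conjI ballI)
  define \<B> where "\<B> = {U. openin X U \<and> countable (X frontier_of U)}"
  show "countable (X frontier_of U)" if "U \<in> \<B>" for U using that by (simp add: \<B>_def)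
  show "openin X = arbitrary union_of (\<lambda>U. U \<in> \<B>)"
    unfolding openin_topology_base_unique
  proof (intro conjI allI impI; (elim conjE)?)
    show "openin X V" if "V \<in> \<B>" for V using that by (simp add: \<B>_def)
    fix U p assume U: "openin X U" and p: "p \<in> U"
    have pX: "p \<in> topspace X" using U p openin_subset by blast
    define C where "C = topspace X - U"
    have "\<forall>q\<in>C. \<exists>V W. openin X V \<and> openin X W \<and> p \<in> V \<and> q \<in> W \<and> V \<inter> W = {} \<and> countable (X frontier_of V)"
      using separate[OF pX] p unfolding C_def by blast
    from bchoice[OF this] obtain V where
      "\<forall>q\<in>C. \<exists>W. openin X (V q) \<and> openin X W \<and> p \<in> V q \<and> q \<in> W \<and> V q \<inter> W = {} \<and> countable (X frontier_of (V q))"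
      by (elim exE)
    from bchoice[OF this] obtain W where
      "\<forall>q\<in>C. openin X (V q) \<and> openin X (W q) \<and> p \<in> V q \<and> q \<in> W q \<and> V q \<inter> W q = {} \<and> countable (X frontier_of (V q))"
      by (elim exE)
    then have VW: "\<And>q. q \<in> C \<Longrightarrow> openin X (V q)" "\<And>q. q \<in> C \<Longrightarrow> openin X (W q)"
      "\<And>q. q \<in> C \<Longrightarrow> p \<in> V q" "\<And>q. q \<in> C \<Longrightarrow> q \<in> W q" "\<And>q. q \<in> C \<Longrightarrow> V q \<inter> W q = {}"
      "\<And>q. q \<in> C \<Longrightarrow> countable (X frontier_of (V q))"
      by simp_all
    have "compactin X C"
      using U compact unfolding C_def by (intro closedin_compact_space) auto
    then obtain \<F> where \<F>: "finite \<F>" "\<F> \<subseteq> W ` C" "C \<subseteq> \<Union>\<F>"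
    proof -
      have "\<forall>U\<in>W ` C. openin X U" "C \<subseteq> \<Union>(W ` C)" using VW(2,4) by auto
      then have "\<exists>\<F>. finite \<F> \<and> \<F> \<subseteq> W ` C \<and> C \<subseteq> \<Union>\<F>"
        using \<open>compactin X C\<close> unfolding compactin_def by blast
      then show ?thesis using that by blast
    qed
    then obtain D where D: "finite D" "D \<subseteq> C" "\<F> = W ` D" by (meson finite_subset_image)
    define O' where "O' = topspace X \<inter> (\<Inter>q\<in>D. V q)"
    have "openin X O'"
      unfolding O'_def using D(1,2)
    proof (induction D rule: finite_induct)
      case (insert q D)
      have "openin X (V q \<inter> (topspace X \<inter> (\<Inter>q\<in>D. V q)))"
        by (intro openin_Int[OF VW(1) insert.IH]) (use insert.prems in auto)
      moreover have "V q \<inter> (topspace X \<inter> (\<Inter>q\<in>D. V q)) = topspace X \<inter> (\<Inter>q\<in>insert q D. V q)" by auto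
      ultimately show ?case by (simp only:)
    qed simp
    moreover have "countable (X frontier_of O')"
    proof -
      have "X frontier_of O' = X frontier_of (\<Inter>q\<in>D. V q)"
        unfolding O'_def by (metis frontier_of_restrict)
      also have "\<dots> \<subseteq> (\<Union>q\<in>D. X frontier_of (V q))" using D(1)
      proof (induction D rule: finite_induct)
        case empty
        have "X frontier_of UNIV = X frontier_of (topspace X)" by (subst frontier_of_restrict) simp
        then show ?case by simp
      next
        case (insert q D)
        then show ?case using frontier_of_Int_subset[of X "V q" "\<Inter>q\<in>D. V q"] by auto
      qed
      finally show ?thesis
        by (rule countable_subset) (use D(1,2) VW(6) in \<open>auto intro!: countable_UN intro: countable_finite\<close>)
    qed
    moreover have "p \<in> O'" using pX D(2) VW(3) unfolding O'_def by blast
    moreover have "O' \<subseteq> U"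
    proof
      fix r assume r: "r \<in> O'"
      show "r \<in> U"
      proof (rule ccontr)
        assume "r \<notin> U"
        then obtain q where "q \<in> D" "r \<in> W q" using r \<F>(3) D(3) unfolding C_def O'_def by blast
        then show False using r D(2) VW(5) unfolding O'_def by blast
      qed
    qed
    ultimately show "\<exists>V. V \<in> \<B> \<and> p \<in> V \<and> V \<subseteq> U" unfolding \<B>_def by blast
  qed
qed

definition letter_in :: "nat \<Rightarrow> nat set \<Rightarrow> bseq set" where
  "letter_in n B = {p \<in> book. \<exists>b\<in>B. (tail ^^ n) p = page b ((tail ^^ Suc n) p)}"

lemma letter_in_eq: "letter_in n B = book \<inter> (tail ^^ n) -` (\<Union>b\<in>B. page b ` UNIV)"
  unfolding letter_in_def by (auto simp: image_iff)

lemma closed_letter_in: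
  assumes "finite B \<or> 0 \<in> B" shows "closed (letter_in n B)"
proof -
  have "closed (\<Union>b\<in>B. page b ` UNIV)"
    using assms
  proof
    show "closed (\<Union>b\<in>B. page b ` UNIV)" if "finite B"
      using that closed_page_image[OF closed_UNIV] by (intro closed_UN) auto
  qed (rule closed_pages[OF closed_UNIV])
  then show ?thesis
    unfolding letter_in_eq by (intro closed_Int closed_book continuous_closed_vimage isCont_tail_power)
qed

lemma letter_in_Un: "letter_in n B \<union> letter_in n (- B) = book"
proof -
  have "\<exists>b. (tail ^^ n) p = page b ((tail ^^ Suc n) p)" if "p \<in> book" for p
    using that unfolding book_def by blast
  then show ?thesis unfolding letter_in_def by blast
qed

lemma countable_marked: "countable {p \<in> book. \<exists>k. (tail ^^ k) p = mark}"
proof (rule countable_subset)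
  show "countable (range (\<lambda>w :: nat list. pages w mark))" by (intro countable_image) simp
  show "{p \<in> book. \<exists>k. (tail ^^ k) p = mark} \<subseteq> range (\<lambda>w. pages w mark)"
  proof
    fix p assume "p \<in> {p \<in> book. \<exists>k. (tail ^^ k) p = mark}"
    then obtain k where "p \<in> book" "(tail ^^ k) p = mark" by blast
    then obtain w where "p = pages w mark" using book_address[of p k] by metis
    then show "p \<in> range (\<lambda>w. pages w mark)" by blast
  qed
qed

text \<open>
  Two different letters at the same place are only possible for points sent to the mark.
\<close>

lemma countable_letter_in_Int: "countable (letter_in n B \<inter> letter_in n (- B))"
proof (rule countable_subset[OF _ countable_marked])
  show "letter_in n B \<inter> letter_in n (- B) \<subseteq> {p \<in> book. \<exists>k. (tail ^^ k) p = mark}"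
  proof
    fix p assume "p \<in> letter_in n B \<inter> letter_in n (- B)"
    then obtain a b where ab: "a \<in> B" "b \<notin> B" "p \<in> book" "(tail ^^ n) p = page a ((tail ^^ Suc n) p)"
      "(tail ^^ n) p = page b ((tail ^^ Suc n) p)"
      unfolding letter_in_def by blast
    then have "a \<noteq> b" by blast
    have eq: "page a ((tail ^^ Suc n) p) = page b ((tail ^^ Suc n) p)" using ab(4,5) by (rule trans[OF sym])
    have "\<exists>k. (tail ^^ k) ((tail ^^ Suc n) p) = mark"
    proof (cases a b rule: linorder_cases)
      case less then show ?thesis using page_eq_mark_depth[OF eq] by blast
    next
      case greater then show ?thesis using page_eq_mark_depth[OF eq[symmetric]] by blast
    qed (use \<open>a \<noteq> b\<close> in simp)
    then obtain k where "(tail ^^ (k + Suc n)) p = mark" unfolding funpow_add o_apply by blast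
    then show "p \<in> {p \<in> book. \<exists>k. (tail ^^ k) p = mark}" using ab(3) by blast
  qed
qed

text \<open>
  Where two pages meet, the later one also meets page 0.  So a place of the address admits either
  the letter 0 or only one letter.
\<close>

lemma letter_unique_if_not_0:
  assumes "page a p = page b p" "page a p \<noteq> page 0 p" shows "a = b"
proof (rule ccontr)
  assume "a \<noteq> b"
  then have "glue (max a b) p = 0"
    using page_collision[OF assms(1)] page_collision[OF assms(1)[symmetric]]
    by (cases a b rule: linorder_cases) (auto simp: max_def)
  then have "page (max a b) p = page 0 p" by (simp add: page_def)
  then show False using assms by (auto simp: max_def split: if_splits)
qed

lemma countable_frontier_Diff:
  fixes S :: "'a::topological_space set"
  assumes "closed K" "closed L" "K \<union> L = S" "countable (K \<inter> L)"
  shows "openin (top_of_set S) (S - K)" "countable (top_of_set S frontier_of (S - K))"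
proof -
  have K: "closedin (top_of_set S) K" and L: "closedin (top_of_set S) L"
    using assms by (auto intro: closed_subset)
  show "openin (top_of_set S) (S - K)" using K openin_diff[OF openin_topspace K] by simp
  have "top_of_set S closure_of (S - K) \<subseteq> L" using L assms(3) by (intro closure_of_minimal) auto
  moreover have "top_of_set S closure_of (topspace (top_of_set S) - (S - K)) \<subseteq> K"
    using K assms(3) by (intro closure_of_minimal) auto
  ultimately have "top_of_set S frontier_of (S - K) \<subseteq> K \<inter> L" unfolding frontier_of_closures by blast
  then show "countable (top_of_set S frontier_of (S - K))" using assms(4) countable_subset by blast
qed

text \<open>
  At some place n the points p and q have no letter in common.  One of the two letter sets does not
  contain 0, hence is a singleton, and then its points are separated from the rest by two closed sets
  that cover the book and have a countable intersection.
\<close>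

lemma rational_book: "rational_space (top_of_set book)"
proof (rule rational_spaceI)
  show "compact_space (top_of_set book)" using compact_book by (simp add: compact_space_subtopology)
  fix p q assume pq: "p \<in> topspace (top_of_set book)" "q \<in> topspace (top_of_set book)" "p \<noteq> q"
  then have book: "p \<in> book" "q \<in> book" by simp_all
  then obtain n where n: "\<And>a. (tail ^^ n) p = page a ((tail ^^ Suc n) p) \<Longrightarrow>
      (tail ^^ n) q \<noteq> page a ((tail ^^ Suc n) q)"
    using common_address_eq[of p q] pq(3) by blast
  define P Q where "P = {a. (tail ^^ n) p = page a ((tail ^^ Suc n) p)}"
    and "Q = {a. (tail ^^ n) q = page a ((tail ^^ Suc n) q)}"
  have disj: "P \<inter> Q = {}" using n unfolding P_def Q_def by blast
  have single: "\<exists>a. {a. (tail ^^ n) r = page a ((tail ^^ Suc n) r)} = {a}"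
    if r: "r \<in> book" "0 \<notin> {a. (tail ^^ n) r = page a ((tail ^^ Suc n) r)}" for r
  proof -
    obtain a where a: "(tail ^^ n) r = page a ((tail ^^ Suc n) r)" using r(1) unfolding book_def by blast
    have "b = a" if b: "(tail ^^ n) r = page b ((tail ^^ Suc n) r)" for b
    proof (rule letter_unique_if_not_0)
      show "page b ((tail ^^ Suc n) r) = page a ((tail ^^ Suc n) r)" using a b by (rule trans[OF sym, rotated])
      show "page b ((tail ^^ Suc n) r) \<noteq> page 0 ((tail ^^ Suc n) r)"
        using r(2) b by (metis mem_Collect_eq)
    qed
    then show ?thesis using a by blast
  qed
  have sep: "\<exists>B. (finite B \<or> 0 \<in> B) \<and> (finite (- B) \<or> 0 \<in> - B) \<and> P \<subseteq> B \<and> Q \<subseteq> - B"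
  proof (cases "0 \<in> P")
    case True
    then obtain b where "Q = {b}" using single[OF book(2)] disj unfolding Q_def by blast
    then show ?thesis using True disj by (intro exI[of _ "- {b}"]) auto
  next
    case False
    then obtain a where "P = {a}" using single[OF book(1)] unfolding P_def by blast
    then show ?thesis using False disj by (intro exI[of _ "{a}"]) auto
  qed
  then obtain B where B: "finite B \<or> 0 \<in> B" "finite (- B) \<or> 0 \<in> - B" "P \<subseteq> B" "Q \<subseteq> - B" by blast
  let ?K = "letter_in n (- B)" and ?L = "letter_in n B"
  have cover: "?K \<union> ?L = book" "?L \<union> ?K = book" using letter_in_Un[of n B] by auto
  have cnt: "countable (?K \<inter> ?L)" "countable (?L \<inter> ?K)"
    using countable_letter_in_Int[of n B] by (simp_all add: Int_commute)
  have cl: "closed ?K" "closed ?L" using B(1,2) closed_letter_in by blast+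
  have "p \<in> book - ?K" "q \<in> book - ?L"
    using book B(3,4) unfolding letter_in_def P_def Q_def by blast+
  moreover have "(book - ?K) \<inter> (book - ?L) = {}" using cover by blast
  ultimately show "\<exists>V W. openin (top_of_set book) V \<and> openin (top_of_set book) W \<and> p \<in> V \<and> q \<in> W \<and>
      V \<inter> W = {} \<and> countable (top_of_set book frontier_of V)"
    using countable_frontier_Diff[OF cl cover(1) cnt(1)] countable_frontier_Diff[OF cl(2,1) cover(2) cnt(2)]
    by blast
qed

section \<open>Transport to real sequences\<close>

lemma rational_space_homeomorphic_map:
  assumes f: "homeomorphic_map X Y f" and X: "rational_space X"
  shows "rational_space Y"
proof -
  obtain \<B> where base: "openin X = arbitrary union_of (\<lambda>U. U \<in> \<B>)"
    and frontier: "\<forall>U\<in>\<B>. countable (X frontier_of U)"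
    using X unfolding rational_space_def base_of_def by (elim exE conjE)
  have op: "openin X U" if "U \<in> \<B>" for U
    using base that unfolding openin_topology_base_unique by simp
  have nb: "\<exists>V. V \<in> \<B> \<and> x \<in> V \<and> V \<subseteq> U" if "openin X U" "x \<in> U" for U x
    using base that unfolding openin_topology_base_unique by simp
  show ?thesis unfolding rational_space_def base_of_def openin_topology_base_unique
  proof (intro exI[of _ "(`) f ` \<B>"] conjI allI impI ballI; (elim conjE)?)
    fix V assume "V \<in> (`) f ` \<B>"
    then obtain U where "U \<in> \<B>" "V = f ` U" by blast
    then show "openin Y V"
      using op[of U] homeomorphic_imp_open_map[OF f] unfolding open_map_def by simp
  next
    fix U y assume U: "openin Y U" "y \<in> U"
    define U' where "U' = {x \<in> topspace X. f x \<in> U}"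
    have "openin X U'" unfolding U'_def
      by (rule openin_continuous_map_preimage[OF homeomorphic_imp_continuous_map[OF f] U(1)])
    moreover have "y \<in> f ` topspace X"
      using U openin_subset[OF U(1)] homeomorphic_imp_surjective_map[OF f] by blast
    then obtain x where x: "x \<in> U'" "f x = y" using U(2) unfolding U'_def by blast
    ultimately obtain V where "V \<in> \<B>" "x \<in> V" "V \<subseteq> U'" using nb[of U' x] by blast
    then show "\<exists>V. V \<in> (`) f ` \<B> \<and> y \<in> V \<and> V \<subseteq> U" using x(2) unfolding U'_def by blast
  next
    fix V assume "V \<in> (`) f ` \<B>"
    then obtain U where U: "U \<in> \<B>" "V = f ` U" by blast
    then have "Y frontier_of V = f ` (X frontier_of U)"
      using homeomorphic_map_frontier_of[OF f openin_subset[OF op[OF U(1)]]] by simp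
    then show "countable (Y frontier_of V)" using frontier U(1) by simp
  qed
qed

lemma omega_sac_homeomorphic_map:
  assumes f: "homeomorphic_map X Y f" and X: "omega_sac X"
  shows "omega_sac Y"
  unfolding omega_sac_def n_sac_def
proof (intro allI impI)
  fix n :: nat and y :: "nat \<Rightarrow> 'b"
  assume n: "2 \<le> n" and y: "y ` {1..n} \<subseteq> topspace Y \<and> inj_on y {1..n}"
  define g where "g = inv_into (topspace X) f"
  have surj: "f ` topspace X = topspace Y" by (rule homeomorphic_imp_surjective_map[OF f])
  have g: "g (y i) \<in> topspace X" "f (g (y i)) = y i" if i: "i \<in> {1..n}" for i
  proof -
    have "y i \<in> f ` topspace X" using y i unfolding surj by blast
    then show "g (y i) \<in> topspace X" "f (g (y i)) = y i"
      unfolding g_def by (simp_all add: inv_into_into f_inv_into_f)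
  qed
  have gX: "(\<lambda>i. g (y i)) ` {1..n} \<subseteq> topspace X" using g(1) by blast
  have g_inj: "inj_on (\<lambda>i. g (y i)) {1..n}"
  proof (rule inj_onI)
    fix i j assume ij: "i \<in> {1..n}" "j \<in> {1..n}" "g (y i) = g (y j)"
    have "y i = f (g (y i))" by (rule g(2)[OF ij(1), symmetric])
    also have "\<dots> = y j" unfolding ij(3) by (rule g(2)[OF ij(2)])
    finally have "y i = y j" .
    then show "i = j" by (rule inj_onD[OF conjunct2[OF y] _ ij(1,2)])
  qed
  obtain \<alpha> t where "arc_in X \<alpha>" and t: "t ` {1..n} \<subseteq> {0..1::real}" "strict_mono_on {1..n} t"
    "\<forall>i\<in>{1..n}. \<alpha> (t i) = g (y i)"
  proof -
    have "n_sac n X" using X n unfolding omega_sac_def by blast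
    then have "\<exists>\<alpha> t. arc_in X \<alpha> \<and> t ` {1..n} \<subseteq> {0..1} \<and> strict_mono_on {1..n} t \<and> (\<forall>i\<in>{1..n}. \<alpha> (t i) = g (y i))"
      using conjI[OF gX g_inj] unfolding n_sac_def by (elim allE impE)
    then show ?thesis using that by (elim exE conjE)
  qed
  have "embedding_map X Y f" unfolding embedding_map_def using f surj by simp
  with \<open>arc_in X \<alpha>\<close> have "arc_in Y (f \<circ> \<alpha>)"
    unfolding arc_in_def by (rule embedding_map_compose)
  moreover have "\<forall>i\<in>{1..n}. (f \<circ> \<alpha>) (t i) = y i" using t(3) g(2) by simp
  ultimately show "\<exists>\<alpha> t. arc_in Y \<alpha> \<and> t ` {1..n} \<subseteq> {0..1} \<and> strict_mono_on {1..n} t \<and>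
      (\<forall>i\<in>{1..n}. \<alpha> (t i) = y i)"
    using t(1,2) by blast
qed

text \<open>
  Copying the metric along an injective map moves a space to another carrier type.
\<close>

lemma metric_on_injective_image:
  fixes S :: "'a::metric_space set" and f :: "'a \<Rightarrow> 'b"
  assumes inj: "inj_on f S"
  obtains m :: "'b metric" where "mspace m = f ` S" "homeomorphic_map (top_of_set S) (mtopology_of m) f"
proof -
  define d where "d u v = dist (inv_into S f u) (inv_into S f v)" for u v
  interpret M2: Metric_space "f ` S" d
  proof
    show "(d u v = 0) = (u = v)" if "u \<in> f ` S" "v \<in> f ` S" for u v
      using inv_into_injective[OF _ that] by (auto simp: d_def)
  qed (auto simp: d_def dist_commute dist_triangle)
  interpret M12: Metric_space12 S dist "f ` S" d
    by (simp add: Metric_space12_def M2.Metric_space_axioms Met_TC.subspace)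
  have "homeomorphic_map M12.M1.mtopology M2.mtopology f"
    by (rule M12.isometry_imp_homeomorphic_map) (auto simp: d_def inj)
  moreover have "M12.M1.mtopology = top_of_set S"
  proof -
    interpret Submetric UNIV dist S by standard simp
    show ?thesis using mtopology_submetric by simp
  qed
  ultimately show ?thesis
    using that[of "metric (f ` S, d)"] M2.mspace_metric M2.mtopology_of by metis
qed

theorem theorem11:
  shows "\<exists>m :: point metric.
           continuum m \<and> nondegenerate m \<and> locally_connected_space (mtopology_of m) \<and>
           rational_space (mtopology_of m) \<and> omega_sac (mtopology_of m)"
proof -
  have "inj_on apply_bcontfun book"
    by (rule inj_onI) (simp add: apply_bcontfun_inject)
  then obtain m :: "point metric" where m: "mspace m = apply_bcontfun ` book"
    and f: "homeomorphic_map (top_of_set book) (mtopology_of m) apply_bcontfun"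
    by (rule metric_on_injective_image)
  have homeo: "top_of_set book homeomorphic_space mtopology_of m"
    using f by (rule homeomorphic_map_imp_homeomorphic_space)
  have "compact_space (top_of_set book)"
    using compact_book by (simp add: compact_space_subtopology)
  moreover have "connected_space (top_of_set book)"
    using connected_book by (simp add: connectedin_def flip: connectedin_iff_connected)
  ultimately have "continuum m"
    unfolding continuum_def
    using homeomorphic_compact_space[OF homeo] homeomorphic_connected_space[OF homeo] by simp
  moreover have "nondegenerate m"
    unfolding nondegenerate_def m
  proof (intro bexI)
    show "apply_bcontfun twos \<noteq> apply_bcontfun mark" by (simp add: apply_bcontfun_inject)
  qed (auto intro: twos_in_book mark_in_book)
  moreover have "locally_connected_space (mtopology_of m)"
    using homeomorphic_locally_connected_space[OF homeo] locally_connected_book by simp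
  moreover have "rational_space (mtopology_of m)"
    by (rule rational_space_homeomorphic_map[OF f rational_book])
  moreover have "omega_sac (mtopology_of m)"
    by (rule omega_sac_homeomorphic_map[OF f omega_sac_book])
  ultimately show ?thesis by blast
qed

end
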